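(* Let $n\ge 1$, let $f_0,\dots,f_n$ be entire functions that are real valued on $\mathbb{R}$, and let $\eta_0,\dots,\eta_n$ be real valued i.i.d. random variables with $\mathbb{E}[\eta_k]=0$, $\mathbb{E}[\eta_k^2]=1$, whose common characteristic function $\phi(s)=\mathbb{E}[e^{is\eta_0}]$ satisfies: for fixed $a>0$ and $q\ge 1$, $$|\phi(s)|\le\frac{1}{(1+as^2)^q}\quad (s\in\mathbb{R}),$$ and $\phi$ is three times differentiable with constants $C_2,C_3>0$ such that $$\sup_{s\in\mathbb{R}}\Big|\frac{d^j\phi(s)}{ds^j}\Big|\le C_j,\qquad j=2,3.$$ Let $P_n(z)=\sum_{k=0}^n\eta_kf_k(z)$ and let $\rho_n(x)$ be the density function for the expected number of real zeros of $P_n$. Then $$\rho_n(x)\le \mathcal K_n(x)\,\frac{1}{aq}\Big[k_1+C_3k_2+\frac{1}{\sqrt{aq}}\,C_2\,(k_3+C_2k_4)\Big],$$ where $\mathcal K_n(x)=\dfrac{\sqrt{K_n^{(1,1)}(x,x)K_n(x,x)-(K_n^{(0,1)}(x,x))^2}}{K_n(x,x)}$ with $K_n(x,x)=\sum_{j=0}^nf_j(x)^2$, $K_n^{(0,1)}(x,x)=\sum_{j=0}^nf_j(x)f_j'(x)$, $K_n^{(1,1)}(x,x)=\sum_{j=0}^nf_j'(x)^2$, and where $k_1,k_2,k_3,k_4$ are the constants $$k_1=\tfrac{1}{\pi}\Big(1-\log 2+\tfrac{\pi\sqrt3+\log 8}{9}\Big)\approx 0.36,\quad k_2=\tfrac{1}{9\pi}(\pi\sqrt3+\log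 8)\approx 0.27,$$ $$k_3=\tfrac{1}{\sqrt2}(1-\log 2)\approx 0.21,\quad k_4=\tfrac{\sqrt2}{9}(\pi\sqrt3+\log 8)\approx 1.18.$$
   Context: The density $\rho_n$ is the Kac–Rice intensity: $\rho_n(x)=\int_{\mathbb{R}}|\eta|\,D_n(0,\eta;x)\,d\eta$, where $D_n(\xi,\eta;x)$ is the joint distribution density of $(P_n(x),P_n'(x))$, so that the expected number of real zeros of $P_n$ in a measurable $\Omega\subset\mathbb{R}$ equals $\int_\Omega\rho_n(x)\,dx$. The bound is asserted at points $x$ where $K_n(x,x)>0$ and $K_n^{(1,1)}(x,x)K_n(x,x)-K_n^{(0,1)}(x,x)^2>0$. *)

theory Defs
  imports "HOL-Probability.Probability" "HOL-Complex_Analysis.Complex_Analysis"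
begin

definition rfun :: "(complex \<Rightarrow> complex) \<Rightarrow> real \<Rightarrow> real" where
  "rfun f x = Re (f (complex_of_real x))"

definition rderiv :: "(complex \<Rightarrow> complex) \<Rightarrow> real \<Rightarrow> real" where
  "rderiv f x = Re (deriv f (complex_of_real x))"

definition Kn :: "(nat \<Rightarrow> complex \<Rightarrow> complex) \<Rightarrow> nat \<Rightarrow> real \<Rightarrow> real" where
  "Kn f n x = (\<Sum>j=0..n. (rfun (f j) x)^2)"

definition Kn01 :: "(nat \<Rightarrow> complex \<Rightarrow> complex) \<Rightarrow> nat \<Rightarrow> real \<Rightarrow> real" where
  "Kn01 f n x = (\<Sum>j=0..n. rfun (f j) x * rderiv (f j) x)"

definition Kn11 :: "(nat \<Rightarrow> complex \<Rightarrow> complex) \<Rightarrow> nat \<Rightarrow> real \<Rightarrow> real" where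
  "Kn11 f n x = (\<Sum>j=0..n. (rderiv (f j) x)^2)"

definition calK :: "(nat \<Rightarrow> complex \<Rightarrow> complex) \<Rightarrow> nat \<Rightarrow> real \<Rightarrow> real" where
  "calK f n x = sqrt (Kn11 f n x * Kn f n x - (Kn01 f n x)^2) / Kn f n x"

definition Pn :: "(nat \<Rightarrow> 'a \<Rightarrow> real) \<Rightarrow> (nat \<Rightarrow> complex \<Rightarrow> complex) \<Rightarrow> nat \<Rightarrow> real \<Rightarrow> 'a \<Rightarrow> real" where
  "Pn \<eta> f n x \<omega> = (\<Sum>k=0..n. \<eta> k \<omega> * rfun (f k) x)"

definition Pn' :: "(nat \<Rightarrow> 'a \<Rightarrow> real) \<Rightarrow> (nat \<Rightarrow> complex \<Rightarrow> complex) \<Rightarrow> nat \<Rightarrow> real \<Rightarrow> 'a \<Rightarrow> real" where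
  "Pn' \<eta> f n x \<omega> = (\<Sum>k=0..n. \<eta> k \<omega> * rderiv (f k) x)"

text \<open>The (continuous version of the) joint density D_n(\<xi>,\<eta>;x) of (P_n(x), P_n'(x)).
  A continuous density is unique, so this is well defined whenever it exists.\<close>
definition joint_density ::
  "'a measure \<Rightarrow> (nat \<Rightarrow> 'a \<Rightarrow> real) \<Rightarrow> (nat \<Rightarrow> complex \<Rightarrow> complex) \<Rightarrow> nat \<Rightarrow> real \<Rightarrow> real \<times> real \<Rightarrow> real"
  where
  "joint_density M \<eta> f n x = (SOME D. continuous_on UNIV D \<and> (\<forall>z. 0 \<le> D z) \<and>
      distributed M lborel (\<lambda>\<omega>. (Pn \<eta> f n x \<omega>, Pn' \<eta> f n x \<omega>)) (\<lambda>z. ennreal (D z)))"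

definition kac_rice_density ::
  "'a measure \<Rightarrow> (nat \<Rightarrow> 'a \<Rightarrow> real) \<Rightarrow> (nat \<Rightarrow> complex \<Rightarrow> complex) \<Rightarrow> nat \<Rightarrow> real \<Rightarrow> ennreal"
  where
  "kac_rice_density M \<eta> f n x =
     (\<integral>\<^sup>+ t. ennreal (\<bar>t\<bar> * joint_density M \<eta> f n x (0, t)) \<partial>lborel)"

definition k1 :: real where "k1 = (1 / pi) * (1 - ln 2 + (pi * sqrt 3 + ln 8) / 9)"
definition k2 :: real where "k2 = (1 / (9 * pi)) * (pi * sqrt 3 + ln 8)"
definition k3 :: real where "k3 = (1 / sqrt 2) * (1 - ln 2)"
definition k4 :: real where "k4 = (sqrt 2 / 9) * (pi * sqrt 3 + ln 8)"

end

theory Submission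
  imports Defs
begin

text \<open>
  Let \<open>\<alpha>\<close> be the vector of the \<open>f\<^sub>k(x)\<close> and \<open>\<beta>\<close> the component of the vector of the \<open>f\<^sub>k'(x)\<close> orthogonal to
  \<open>\<alpha>\<close>; then \<open>calK = |\<beta>| / |\<alpha>|\<close>, and given \<open>P\<^sub>n(x) = 0\<close> the derivative equals \<open>Y = \<Sum> \<beta>\<^sub>k \<eta>\<^sub>k\<close>.
  By Fatou it suffices to bound \<open>E[|Y|; |X| < e] / (2 e)\<close> with \<open>X = \<Sum> \<alpha>\<^sub>k \<eta>\<^sub>k\<close>. Split the indices into
  blocks \<open>A\<close>, \<open>B\<close> and use \<open>|Y| \<le> |Y\<^sub>A| + |Y\<^sub>B|\<close>: since \<open>X\<^sub>B\<close> is independent of \<open>(X\<^sub>A, Y\<^sub>A)\<close> and its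
  characteristic function is at most \<open>1 / (1 + a q |\<alpha>\<^sub>B|\<^sup>2 t\<^sup>2)\<close>, Fourier inversion bounds its density and
  \<open>E[|Y\<^sub>A|; |X| < e] \<le> |\<beta>\<^sub>A| e / (sqrt (a q) |\<alpha>\<^sub>B|)\<close>. A good choice of blocks gives the bound
  \<open>sqrt 2 / sqrt (a q) * calK\<close>. Comparing the decay of the characteristic function with its Taylor expansion
  at 0 gives \<open>C2 \<ge> 2 a q\<close>, from which this bound is below the claimed one.
\<close>

subsection \<open>Fourier inversion for integrable characteristic functions\<close>

text \<open>Levy inversion gives the mass as a limit of integrals over \<open>]-T, T[\<close>. Once
  \<open>char M\<close> is integrable, \<open>(b - a) * cmod (char M t)\<close> dominates the
  integrand, so the limit is an ordinary integral over the whole line.\<close>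

lemma (in real_distribution) measure_Ioc_eq_char_integral:
  assumes "a \<le> b" "measure M {a} = 0" "measure M {b} = 0" and int: "integrable lborel (char M)"
  shows "complex_of_real (measure M {a<..b}) =
    1 / (2 * pi) * (CLBINT t. (iexp (-(t * a)) - iexp (-(t * b))) / (\<i> * t) * char M t)"
proof -
  let ?F = "\<lambda>t. (iexp (-(t * a)) - iexp (-(t * b))) / (\<i> * t) * char M t"
  \<comment> \<open>The kernel is the integral of a unimodular function over an interval of length
    \<open>b - a\<close>. At \<open>t = 0\<close> division by zero makes it 0, so the bound holds
    there as well.\<close>
  have bound: "cmod (?F t) \<le> (b - a) * cmod (char M t)" for t
  proof (cases "t = 0")
    case False
    then have "cmod ((iexp (t * (-a)) - iexp (t * (-b))) / (\<i> * t)) \<le> b - a"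
      using Levy_Inversion_aux2[of "-b" "-a" t] assms(1) by simp
    then show ?thesis
      unfolding norm_mult by (intro mult_right_mono) auto
  qed (use assms(1) in simp)
  have "(\<lambda>T::nat. CLBINT t. indicator {-real T<..<real T} t *\<^sub>R ?F t) \<longlonglongrightarrow> (CLBINT t. ?F t)"
  proof (rule integral_dominated_convergence[where w="\<lambda>t. (b - a) * cmod (char M t)"])
    show "integrable lborel (\<lambda>t. (b - a) * cmod (char M t))"
      using int by simp
    show "AE t in lborel. (\<lambda>T::nat. indicator {-real T<..<real T} t *\<^sub>R ?F t) \<longlonglongrightarrow> ?F t"
    proof (rule AE_I2)
      fix t :: real
      have "eventually (\<lambda>T::nat. real T > \<bar>t\<bar>) sequentially"
        using filterlim_real_sequentially by (simp add: filterlim_at_top_dense)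
      then have "eventually (\<lambda>T::nat. indicator {-real T<..<real T} t *\<^sub>R ?F t = ?F t) sequentially"
        by eventually_elim (simp add: abs_less_iff)
      then show "(\<lambda>T::nat. indicator {-real T<..<real T} t *\<^sub>R ?F t) \<longlonglongrightarrow> ?F t"
        by (rule tendsto_eventually)
    qed
    show "AE t in lborel. cmod (indicator {-real T<..<real T} t *\<^sub>R ?F t) \<le> (b - a) * cmod (char M t)"
      for T :: nat
      using bound assms(1) by (intro AE_I2) (auto split: split_indicator)
  qed measurable
  moreover have "(CLBINT t. indicator {-real T<..<real T} t *\<^sub>R ?F t) = (CLBINT t=-real T..real T. ?F t)"
    for T :: nat
    by (simp add: interval_lebesgue_integral_def set_lebesgue_integral_def)
  ultimately have "(\<lambda>T::nat. 1 / (2 * pi) * (CLBINT t=-real T..real T. ?F t))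
      \<longlonglongrightarrow> 1 / (2 * pi) * (CLBINT t. ?F t)"
    by (intro tendsto_mult tendsto_const) simp
  moreover have "(\<lambda>T::nat. 1 / (2 * pi) * (CLBINT t=-real T..real T. ?F t)) \<longlonglongrightarrow> measure M {a<..b}"
    using Levy_Inversion[OF assms(1-3)] by (simp only: of_int_minus of_int_of_nat_eq)
  ultimately show ?thesis
    by (rule LIMSEQ_unique[rotated])
qed

text \<open>The inverse Fourier transform of the characteristic function. Taking the real part makes
  it real valued at once, without a proof that the integral is real.\<close>

definition (in real_distribution) char_density :: "real \<Rightarrow> real" where
  "char_density x = Re (1 / (2 * pi) * (CLBINT t. iexp (-(t * x)) * char M t))"

lemma (in real_distribution) norm_char_integral_le:
  "cmod (1 / (2 * pi) * (CLBINT t. iexp (-(t * x)) * char M t)) \<le>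
    1 / (2 * pi) * (LBINT t. cmod (char M t))"
proof -
  have "cmod (CLBINT t. iexp (-(t * x)) * char M t) \<le> (LBINT t. cmod (iexp (-(t * x)) * char M t))"
    by (rule integral_norm_bound)
  also have "\<dots> = (LBINT t. cmod (char M t))"
    by (simp add: norm_mult norm_exp_i_times[of "of_real _", simplified] flip: of_real_mult of_real_minus)
  finally show ?thesis
    by (simp add: norm_mult norm_divide divide_right_mono)
qed

lemma (in real_distribution) char_density_le:
  "\<bar>char_density x\<bar> \<le> 1 / (2 * pi) * (LBINT t. cmod (char M t))"
  unfolding char_density_def
  by (rule order_trans[OF abs_Re_le_cmod norm_char_integral_le])

lemma (in real_distribution) continuous_char_density:
  assumes int: "integrable lborel (char M)"
  shows "isCont char_density x"
proof -
  have "isCont (\<lambda>x. CLBINT t. iexp (-(t * x)) * char M t) x"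
    unfolding continuous_at_sequentially
  proof safe
    fix X assume X: "X \<longlonglongrightarrow> x"
    have "(\<lambda>n. CLBINT t. iexp (-(t * X n)) * char M t) \<longlonglongrightarrow> (CLBINT t. iexp (-(t * x)) * char M t)"
      by (rule integral_dominated_convergence[where w="\<lambda>t. cmod (char M t)"])
        (use X int in \<open>auto intro!: tendsto_intros simp: norm_mult\<close>)
    then show "((\<lambda>x. CLBINT t. iexp (-(t * x)) * char M t) \<circ> X)
        \<longlonglongrightarrow> (CLBINT t. iexp (-(t * x)) * char M t)"
      by (simp add: o_def)
  qed
  then show ?thesis
    unfolding char_density_def[abs_def] by (intro continuous_Re continuous_mult continuous_const)
qed

text \<open>The Levy kernel is the integral of \<open>iexp (-(t * x))\<close> over \<open>x\<close>
  in \<open>{a<..b}\<close>. Fubini exchanges the two integrals, and the inner one becomes the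
  inverse Fourier transform at \<open>x\<close>.\<close>

lemma (in real_distribution) measure_Ioc_eq_integral_char_density:
  assumes ab: "a \<le> b" "measure M {a} = 0" "measure M {b} = 0" and int: "integrable lborel (char M)"
  shows "measure M {a<..b} = (LBINT x. indicator {a<..b} x * char_density x)"
proof -
  let ?g = "\<lambda>(t, x). indicator {a<..b} x *\<^sub>R (iexp (-(t * x)) * char M t)"
  have inner: "(CLBINT x. indicator {a<..b} x *\<^sub>R iexp (-(t * x)))
      = (iexp (-(t * a)) - iexp (-(t * b))) / (\<i> * t)" if "t \<noteq> 0" for t :: real
  proof -
    have "(CLBINT x=a..b. iexp (-(t * x))) = - iexp (-(t * b)) / (\<i> * t) - (- iexp (-(t * a)) / (\<i> * t))"
    proof (rule interval_integral_FTC_finite)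
      show "continuous_on {min a b..max a b} (\<lambda>x. iexp (-(t * x)))"
        by (intro continuous_intros)
      fix x
      have "((\<lambda>x. - exp (\<i> * (-(t * x))) / (\<i> * t)) has_field_derivative exp (\<i> * (-(t * z)))) (at z)" for z :: complex
        using that by (auto intro!: derivative_eq_intros simp: mult.commute[of "exp _" \<i>])
      from has_vector_derivative_real_field[OF this, of x "{min a b..max a b}"]
      show "((\<lambda>x. - iexp (-(t * x)) / (\<i> * t)) has_vector_derivative iexp (-(t * x)))
          (at x within {min a b..max a b})"
        by (simp add: o_def)
    qed
    then show ?thesis
      using ab(1) by (simp add: interval_integral_Ioc set_lebesgue_integral_def diff_divide_distrib)
  qed
  have g_int: "integrable (lborel \<Otimes>\<^sub>M lborel) ?g"
  proof (rule lborel_pair.Fubini_integrable)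
    have "integrable lborel (\<lambda>t. (b - a) * cmod (char M t))"
      using int by simp
    also have "(\<lambda>t. (b - a) * cmod (char M t)) = (\<lambda>t. LBINT x. cmod (?g (t, x)))"
      using ab(1) by (simp add: norm_mult fun_eq_iff)
    finally show "integrable lborel (\<lambda>t. LBINT x. cmod (?g (t, x)))" .
    show "AE t in lborel. integrable lborel (\<lambda>x. ?g (t, x))"
    proof (rule AE_I2)
      fix t
      show "integrable lborel (\<lambda>x. ?g (t, x))"
        unfolding prod.case
        by (rule integrableI_bounded_set_indicator[where B="cmod (char M t)"])
           (use ab in \<open>auto simp: norm_mult\<close>)
    qed
  qed measurable
  have "complex_of_real (measure M {a<..b}) =
      1 / (2 * pi) * (CLBINT t. (iexp (-(t * a)) - iexp (-(t * b))) / (\<i> * t) * char M t)"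
    by (rule measure_Ioc_eq_char_integral[OF ab int])
  also have "(CLBINT t. (iexp (-(t * a)) - iexp (-(t * b))) / (\<i> * t) * char M t)
      = (CLBINT t. CLBINT x. ?g (t, x))"
  proof (rule integral_cong_AE)
    \<comment> \<open>Only almost everywhere: at \<open>t = 0\<close> the quotient is 0 by
      convention, whereas the integral over \<open>x\<close> gives \<open>b - a\<close>.\<close>
    show "AE t in lborel. (iexp (-(t * a)) - iexp (-(t * b))) / (\<i> * t) * char M t
        = (CLBINT x. ?g (t, x))"
      using AE_lborel_singleton[of 0]
    proof eventually_elim
      case (elim t)
      have "(CLBINT x. ?g (t, x)) = (CLBINT x. indicator {a<..b} x *\<^sub>R iexp (-(t * x)) * char M t)"
        by simp
      also have "\<dots> = (CLBINT x. indicator {a<..b} x *\<^sub>R iexp (-(t * x))) * char M t"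
        by (rule integral_mult_left_zero)
      finally show ?case
        using inner elim by simp
    qed
  qed measurable
  also have "\<dots> = (CLBINT x. CLBINT t. ?g (t, x))"
    using lborel_pair.Fubini_integral[OF g_int] by simp
  also have "(CLBINT x. CLBINT t. ?g (t, x)) = (CLBINT x. indicator {a<..b} x *\<^sub>R (CLBINT t. iexp (-(t * x)) * char M t))"
    by simp
  also have "1 / (2 * pi) * \<dots> = (CLBINT x. 1 / (2 * pi) * (indicator {a<..b} x *\<^sub>R (CLBINT t. iexp (-(t * x)) * char M t)))"
    by (rule integral_mult_right_zero[symmetric])
  finally have eq: "complex_of_real (measure M {a<..b}) =
      (CLBINT x. indicator {a<..b} x *\<^sub>R (1 / (2 * pi) * (CLBINT t. iexp (-(t * x)) * char M t)))"
    by (simp only: mult_scaleR_right)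
  have "integrable lborel (\<lambda>x. indicator {a<..b} x *\<^sub>R (1 / (2 * pi) * (CLBINT t. iexp (-(t * x)) * char M t)))"
    by (rule integrableI_bounded_set_indicator[where B="1 / (2 * pi) * (LBINT t. cmod (char M t))"])
      (use ab norm_char_integral_le in auto)
  from integral_Re[OF this] arg_cong[OF eq, of Re] show ?thesis
    by (simp add: char_density_def)
qed

lemma (in real_distribution) char_density_measurable:
  assumes int: "integrable lborel (char M)"
  shows "char_density \<in> borel_measurable borel"
  by (intro borel_measurable_continuous_onI continuous_at_imp_continuous_on)
     (use continuous_char_density[OF int] in auto)

lemma (in real_distribution) integrable_char_density_Ioc:
  assumes int: "integrable lborel (char M)"
  shows "integrable lborel (\<lambda>x. indicator {a<..b} x * char_density x)"
proof -
  have "integrable lborel (\<lambda>x. indicator {a<..b} x *\<^sub>R char_density x)"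
    by (rule integrableI_bounded_set_indicator[where B="1 / (2 * pi) * (LBINT t. cmod (char M t))"])
      (use char_density_le char_density_measurable[OF int] emeasure_bounded_finite[OF bounded_Ioc, of a b] in auto)
  then show ?thesis by simp
qed

text \<open>Since atoms are countable, \<open>x\<close> can be enclosed in arbitrarily short
  intervals with null endpoints. There the inversion formula applies, and the mass is at most a
  constant times the length. This discharges the endpoint conditions of the formula.\<close>

lemma (in real_distribution) no_atoms_if_char_integrable:
  assumes int: "integrable lborel (char M)"
  shows "measure M {x} = 0"
proof -
  define J where "J = 1 / (2 * pi) * (LBINT t. cmod (char M t))"
  have null_ex: "\<exists>y. c < y \<and> y < d \<and> measure M {y} = 0" if "c < d" for c d
  proof -
    have "\<not> {c<..<d} \<subseteq> {x. measure M {x} > 0}"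
      using countable_atoms uncountable_open_interval that countable_subset by blast
    then show ?thesis
      by (auto simp: less_le)
  qed
  have "measure M {x} \<le> 0 + e" if "e > 0" for e
  proof -
    have J: "J \<ge> 0"
      by (simp add: J_def)
    \<comment> \<open>Chosen so that \<open>2 * d * (J + 1) = e\<close>; the added 1 avoids a
      division by zero.\<close>
    define d where "d = e / (2 * (J + 1))"
    have d: "d > 0"
      using that J by (simp add: d_def)
    obtain a b where a: "x - d < a" "a < x" "measure M {a} = 0"
      and b: "x < b" "b < x + d" "measure M {b} = 0"
      using null_ex[of "x - d" x] null_ex[of x "x + d"] d by auto
    have "measure M {x} \<le> measure M {a<..b}"
      using a b by (intro finite_measure_mono) auto
    also have "\<dots> = (LBINT x. indicator {a<..b} x * char_density x)"
      using a b by (intro measure_Ioc_eq_integral_char_density int) auto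
    also have "\<dots> \<le> (LBINT x. indicator {a<..b} x * J)"
    proof (rule integral_mono)
      show "integrable lborel (\<lambda>x. indicator {a<..b} x * char_density x)"
        by (rule integrable_char_density_Ioc[OF int])
      show "indicator {a<..b} x * char_density x \<le> indicator {a<..b} x * J" for x
        using char_density_le[of x] by (auto simp: J_def split: split_indicator)
    qed (use a b in simp)
    also have "\<dots> = (b - a) * J"
      using a b by simp
    also have "\<dots> \<le> (2 * d) * (J + 1)"
      using a b J by (intro mult_mono) auto
    also have "\<dots> = e"
      using J by (simp add: d_def field_simps add_nonneg_eq_0_iff)
    finally show ?thesis by simp
  qed
  then have "measure M {x} \<le> 0"
    by (rule field_le_epsilon)
  then show ?thesis
    by (simp add: order_antisym)
qed

text \<open>By continuity a negative value would persist on an interval to the right of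
  \<open>x\<close>, whose measure would then be negative.\<close>

lemma (in real_distribution) char_density_nonneg:
  assumes int: "integrable lborel (char M)"
  shows "char_density x \<ge> 0"
proof (rule ccontr)
  assume "\<not> char_density x \<ge> 0"
  then have neg: "char_density x < 0" by simp
  have "\<forall>\<^sub>F y in at x. char_density y < char_density x / 2"
    using continuous_char_density[OF int, of x] neg unfolding isCont_def
    by (intro order_tendstoD(2)) auto
  then obtain d where d: "d > 0" and less: "\<And>y. y \<noteq> x \<Longrightarrow> dist y x < d \<Longrightarrow> char_density y < char_density x / 2"
    unfolding eventually_at by auto
  note [measurable] = char_density_measurable[OF int]
  have "measure M {x<..x + d / 2} = (LBINT y. indicator {x<..x + d / 2} y * char_density y)"
    using d by (intro measure_Ioc_eq_integral_char_density no_atoms_if_char_integrable int) auto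
  also have "\<dots> \<le> (LBINT y. indicator {x<..x + d / 2} y * (char_density x / 2))"
  proof (rule integral_mono)
    show "integrable lborel (\<lambda>y. indicator {x<..x + d / 2} y * char_density y)"
      by (rule integrable_char_density_Ioc[OF int])
    show "indicator {x<..x + d / 2} y * char_density y \<le> indicator {x<..x + d / 2} y * (char_density x / 2)" for y
      using less[of y] d by (auto simp: dist_real_def split: split_indicator)
  qed (use d in simp)
  also have "\<dots> = d / 2 * (char_density x / 2)"
    using d by simp
  also have "\<dots> < 0"
    using d neg by (simp add: mult_pos_neg)
  finally show False
    by (simp add: not_less[symmetric])
qed

text \<open>The interval formula covers bounded intervals only, so each half line
  \<open>{x<..}\<close> is exhausted by intervals of length \<open>n\<close>. Half lines determine
  the measure.\<close>

lemma (in real_distribution) eq_density_char_density: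
  assumes int: "integrable lborel (char M)"
  shows "M = density lborel (\<lambda>x. ennreal (char_density x))"
proof (rule measure_eqI_lessThan)
  note [measurable] = char_density_measurable[OF int]
  fix x :: real
  show "emeasure M {x<..} < \<infinity>"
    by (simp add: less_top[symmetric])
  let ?I = "\<lambda>n::nat. {x<..x + real n}"
  have UN: "(\<Union>n. ?I n) = {x<..}"
  proof safe
    fix y assume "y > x"
    obtain n :: nat where "y - x \<le> real n"
      using real_arch_simple by blast
    with \<open>y > x\<close> show "y \<in> (\<Union>n. ?I n)"
      by (intro UN_I[of n]) auto
  qed auto
  have inc: "incseq ?I"
    by (auto simp: incseq_def)
  have "emeasure M (?I n) = emeasure (density lborel (\<lambda>x. ennreal (char_density x))) (?I n)" for n
  proof -
    have "integrable lborel (\<lambda>y. indicator (?I n) y * char_density y)"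
      by (rule integrable_char_density_Ioc[OF int])
    then have "ennreal (measure M (?I n)) = (\<integral>\<^sup>+y. ennreal (indicator (?I n) y * char_density y) \<partial>lborel)"
      by (subst measure_Ioc_eq_integral_char_density)
         (auto simp: int no_atoms_if_char_integrable char_density_nonneg intro!: nn_integral_eq_integral[symmetric])
    also have "\<dots> = emeasure (density lborel (\<lambda>x. ennreal (char_density x))) (?I n)"
      by (subst emeasure_density) (auto intro!: nn_integral_cong split: split_indicator)
    finally show ?thesis
      by (simp add: emeasure_eq_measure)
  qed
  moreover have "(\<lambda>n. emeasure M (?I n)) \<longlonglongrightarrow> emeasure M {x<..}"
    unfolding UN[symmetric] by (rule Lim_emeasure_incseq[OF _ inc]) auto
  moreover have "(\<lambda>n. emeasure (density lborel (\<lambda>x. ennreal (char_density x))) (?I n))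
      \<longlonglongrightarrow> emeasure (density lborel (\<lambda>x. ennreal (char_density x))) {x<..}"
    unfolding UN[symmetric] by (rule Lim_emeasure_incseq[OF _ inc]) auto
  ultimately show "emeasure M {x<..} = emeasure (density lborel (\<lambda>x. ennreal (char_density x))) {x<..}"
    by (simp only:) (rule LIMSEQ_unique)
qed auto

section \<open>Density and concentration bounds under quadratic decay of the characteristic
  function\<close>

lemma has_bochner_integral_inverse_quadratic:
  fixes c :: real
  assumes c: "c > 0"
  shows "has_bochner_integral lborel (\<lambda>t. 1 / (1 + c * t\<^sup>2)) (pi / sqrt c)"
proof -
  have pos: "1 + c * t\<^sup>2 > 0" for t
    using c by (simp add: add_pos_nonneg)
  have deriv: "((\<lambda>t. arctan (sqrt c * t) / sqrt c) has_real_derivative 1 / (1 + c * t\<^sup>2)) (at t)" for t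
    using c pos[of t] by (auto intro!: derivative_eq_intros simp: power_mult_distrib divide_simps mult_ac)
  have top: "((\<lambda>t. arctan (sqrt c * t) / sqrt c) \<longlongrightarrow> (pi / 2) / sqrt c) at_top"
    using c by (intro tendsto_divide filterlim_compose[OF tendsto_arctan_at_top]
        filterlim_tendsto_pos_mult_at_top[OF tendsto_const] filterlim_ident tendsto_const) auto
  have bot: "((\<lambda>t. arctan (sqrt c * t) / sqrt c) \<longlongrightarrow> (- (pi / 2)) / sqrt c) at_bot"
    using c by (intro tendsto_divide filterlim_compose[OF tendsto_arctan_at_bot]
        filterlim_tendsto_pos_mult_at_bot[OF tendsto_const] filterlim_ident tendsto_const) auto
  have "set_integrable lborel (einterval (-\<infinity>) \<infinity>) (\<lambda>t. 1 / (1 + c * t\<^sup>2))"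
    and "(LBINT t=-\<infinity>..\<infinity>. 1 / (1 + c * t\<^sup>2)) = (pi / 2) / sqrt c - (- (pi / 2)) / sqrt c"
    using interval_integral_FTC_nonneg[of "-\<infinity>" \<infinity> "\<lambda>t. arctan (sqrt c * t) / sqrt c" "\<lambda>t. 1 / (1 + c * t\<^sup>2)"]
      deriv top bot pos
    by (auto simp: ereal_tendsto_simps less_imp_le less_imp_neq[symmetric] intro!: continuous_intros)
  then show ?thesis
    by (simp add: has_bochner_integral_iff set_integrable_def interval_lebesgue_integral_def
        set_lebesgue_integral_def field_simps)
qed

text \<open>The majorant has integral \<open>pi / sqrt c\<close>, and the inversion formula
  contributes the factor \<open>1 / (2 * pi)\<close>.\<close>

lemma (in real_distribution) quadratic_char_decay:
  assumes c: "c > 0" and decay: "\<And>t. cmod (char M t) \<le> 1 / (1 + c * t\<^sup>2)"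
  shows integrable_char_if_quadratic_decay: "integrable lborel (char M)"
    and char_density_le_if_quadratic_decay: "char_density x \<le> 1 / (2 * sqrt c)"
proof -
  have int: "integrable lborel (\<lambda>t. 1 / (1 + c * t\<^sup>2))"
    and val: "(LBINT t. 1 / (1 + c * t\<^sup>2)) = pi / sqrt c"
    using has_bochner_integral_inverse_quadratic[OF c] by (auto simp: has_bochner_integral_iff)
  show int': "integrable lborel (char M)"
    by (rule Bochner_Integration.integrable_bound[OF int], measurable)
       (use order_trans[OF decay abs_ge_self] in \<open>simp add: real_norm_def\<close>)
  have "(LBINT t. cmod (char M t)) \<le> pi / sqrt c"
    unfolding val[symmetric] using int int' decay by (intro integral_mono) auto
  then have "1 / (2 * pi) * (LBINT t. cmod (char M t)) \<le> 1 / (2 * pi) * (pi / sqrt c)"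
    by (intro mult_left_mono) auto
  with char_density_le[of x] show "char_density x \<le> 1 / (2 * sqrt c)"
    by simp
qed

text \<open>Uniformity in the centre \<open>y\<close> is the point: an independent summand, once its
  value is fixed, merely moves the interval.\<close>

lemma (in real_distribution) emeasure_Ioo_le_if_quadratic_decay:
  assumes c: "c > 0" and decay: "\<And>t. cmod (char M t) \<le> 1 / (1 + c * t\<^sup>2)" and e: "e \<ge> 0"
  shows "emeasure M {y - e<..<y + e} \<le> ennreal (e / sqrt c)"
proof -
  note int = integrable_char_if_quadratic_decay[OF c decay]
  note [measurable] = char_density_measurable[OF int]
  have "emeasure M {y - e<..<y + e} = (\<integral>\<^sup>+x. ennreal (char_density x) * indicator {y - e<..<y + e} x \<partial>lborel)"
    by (subst eq_density_char_density[OF int]) (simp add: emeasure_density)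
  also have "\<dots> \<le> (\<integral>\<^sup>+x. ennreal (1 / (2 * sqrt c)) * indicator {y - e<..<y + e} x \<partial>lborel)"
    using char_density_le_if_quadratic_decay[OF c decay]
    by (intro nn_integral_mono mult_right_mono ennreal_leI) auto
  also have "\<dots> = ennreal (1 / (2 * sqrt c)) * ennreal (2 * e)"
    using e by (simp add: nn_integral_cmult_indicator)
  also have "\<dots> = ennreal (e / sqrt c)"
    using c e by (subst ennreal_mult[symmetric]) auto
  finally show ?thesis .
qed

subsection \<open>Elementary inequalities\<close>

lemma one_plus_sum_le_prod:
  fixes w :: "'i \<Rightarrow> real"
  assumes "\<And>i. i \<in> I \<Longrightarrow> w i \<ge> 0"
  shows "1 + (\<Sum>i\<in>I. w i) \<le> (\<Prod>i\<in>I. 1 + w i)"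
  using assms
proof (induction I rule: infinite_finite_induct)
  case (insert i I)
  then have IH: "1 + (\<Sum>i\<in>I. w i) \<le> (\<Prod>i\<in>I. 1 + w i)" and w: "w i \<ge> 0" "(\<Sum>i\<in>I. w i) \<ge> 0"
    by (auto intro: sum_nonneg)
  have "1 + (w i + (\<Sum>i\<in>I. w i)) \<le> (1 + w i) * (1 + (\<Sum>i\<in>I. w i))"
    using w by (simp add: algebra_simps)
  also have "\<dots> \<le> (1 + w i) * (\<Prod>i\<in>I. 1 + w i)"
    using w by (intro mult_left_mono IH) auto
  finally show ?case
    using insert.hyps by simp
qed auto

lemma Bernoulli_inequality_powr:
  fixes x q :: real
  assumes "x \<ge> 0" "q \<ge> 1"
  shows "1 + q * x \<le> (1 + x) powr q"
proof -
  have "(1 + 0) powr q - q * 0 \<le> (1 + x) powr q - q * x"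
  proof (rule DERIV_nonneg_imp_nondecreasing[OF assms(1)])
    fix y :: real assume y: "0 \<le> y" "y \<le> x"
    have "((\<lambda>x. (1 + x) powr q - q * x) has_real_derivative q * (1 + y) powr (q - 1) - q) (at y)"
      using y by (auto intro!: derivative_eq_intros)
    moreover have "q * (1 + y) powr (q - 1) - q \<ge> 0"
      using assms y ge_one_powr_ge_zero[of "1 + y" "q - 1"] by simp
    ultimately show "\<exists>z. ((\<lambda>x. (1 + x) powr q - q * x) has_real_derivative z) (at y) \<and> 0 \<le> z"
      by blast
  qed
  then show ?thesis by simp
qed

section \<open>Lower bound for the second-derivative constant and comparison with the stated
  constants\<close>

text \<open>The decay makes 0 a maximum of \<open>g\<close>, so \<open>g1 0 = 0\<close>, and two
  integrations of \<open>g2 \<ge> - C\<close> give \<open>g s \<ge> 1 - C * s\<^sup>2 / 2\<close>.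
  The decay bound behaves like \<open>1 - b * s\<^sup>2\<close> near 0; comparing quadratic terms
  yields the claim.\<close>

lemma curvature_ge_if_quadratic_decay:
  fixes g g1 g2 :: "real \<Rightarrow> real"
  assumes b: "b > 0" and C: "C > 0" and g0: "g 0 = 1"
    and decay: "\<And>s. g s \<le> 1 / (1 + b * s\<^sup>2)"
    and d1: "\<And>s. (g has_real_derivative g1 s) (at s)"
    and d2: "\<And>s. (g1 has_real_derivative g2 s) (at s)"
    and g2: "\<And>s. g2 s \<ge> - C"
  shows "C \<ge> 2 * b"
proof (rule ccontr)
  assume "\<not> C \<ge> 2 * b"
  then have less: "b - C / 2 > 0" by simp
  have g_le: "g s \<le> 1" for s
    using decay[of s] b order_trans[of "g s" "1 / (1 + b * s\<^sup>2)" 1] by (simp add: field_simps add_pos_nonneg)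
  have g1_0: "g1 0 = 0"
    by (rule DERIV_local_max[OF d1, of 1]) (use g_le g0 in auto)
  have h1: "g1 s + C * s \<ge> 0" if "s \<ge> 0" for s
  proof -
    have "g1 0 + C * 0 \<le> g1 s + C * s"
    proof (rule DERIV_nonneg_imp_nondecreasing[OF that])
      fix x :: real
      have "((\<lambda>s. g1 s + C * s) has_real_derivative g2 x + C) (at x)"
        by (auto intro!: derivative_eq_intros d2)
      with g2[of x] show "\<exists>z. ((\<lambda>s. g1 s + C * s) has_real_derivative z) (at x) \<and> 0 \<le> z"
        by (intro exI[of _ "g2 x + C"]) auto
    qed
    with g1_0 show ?thesis by simp
  qed
  have h: "g s + C * s\<^sup>2 / 2 \<ge> 1" if "s \<ge> 0" for s
  proof -
    have "g 0 + C * 0\<^sup>2 / 2 \<le> g s + C * s\<^sup>2 / 2"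
    proof (rule DERIV_nonneg_imp_nondecreasing[OF that])
      fix x :: real assume "0 \<le> x"
      have "((\<lambda>s. g s + C * s\<^sup>2 / 2) has_real_derivative g1 x + C * x) (at x)"
        by (auto intro!: derivative_eq_intros d1)
      with h1[OF \<open>0 \<le> x\<close>] show "\<exists>z. ((\<lambda>s. g s + C * s\<^sup>2 / 2) has_real_derivative z) (at x) \<and> 0 \<le> z"
        by blast
    qed
    with g0 show ?thesis by simp
  qed
  \<comment> \<open>\<open>r\<close> stands for a small \<open>s\<^sup>2\<close>. Clearing
    denominators in the two-sided bound gives \<open>b - C / 2 \<le> b * C * r / 2\<close>, and this
    \<open>r\<close> makes the right side half of the left.\<close>
  define r where "r = (b - C / 2) / (b * C)"
  have r: "r > 0"
    using less b C by (simp add: r_def)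
  have "1 - C * r / 2 \<le> 1 / (1 + b * r)"
    using h[of "sqrt r"] decay[of "sqrt r"] r by simp
  then have "(1 - C * r / 2) * (1 + b * r) \<le> 1"
    using b r by (simp add: pos_le_divide_eq add_pos_pos)
  then have "r * (b - C / 2) \<le> r * (b * C * r / 2)"
    by (simp add: algebra_simps)
  then have "b - C / 2 \<le> b * C * r / 2"
    using r by simp
  also have "\<dots> = (b - C / 2) / 2"
    using b C by (simp add: r_def)
  finally show False
    using less by simp
qed

text \<open>Rational bounds, weak enough for crude estimates of \<open>ln 2\<close>,
  \<open>pi\<close>, \<open>sqrt 2\<close> and \<open>sqrt 3\<close>, yet strong enough for the
  cubic inequality in the next lemma.\<close>

lemma k_lower_bounds: "k1 \<ge> 3 / 10" "k2 \<ge> 0" "k3 \<ge> 1 / 5" "k4 \<ge> 1"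
proof -
  have ln8: "ln 8 = 3 * ln (2::real)"
    using ln_realpow[of 2 3] by simp
  have ln2: "2 / 3 \<le> ln (2::real)" "ln (2::real) \<le> 25 / 36"
    by (fact ln2_ge_two_thirds, fact ln2_le_25_over_36)
  have s3: "sqrt 3 \<ge> 1.7"
    by (rule real_le_rsqrt) (simp add: power2_eq_square)
  have s2: "sqrt 2 \<ge> 1.4" "sqrt 2 \<le> 1.5"
    by (rule real_le_rsqrt real_le_lsqrt; simp add: power2_eq_square)+
  have "3.1 * 1.7 \<le> pi * sqrt 3"
    using s3 pi_approx by (intro mult_mono) auto
  then have A: "pi * sqrt 3 + ln 8 \<ge> 7.2"
    using ln8 ln2 by simp
  then show "k2 \<ge> 0"
    by (simp add: k2_def)
  show "k1 \<ge> 3 / 10"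
    using A ln2 pi_approx by (simp add: k1_def field_simps)
  show "k3 \<ge> 1 / 5"
    using s2 ln2 by (simp add: k3_def field_simps)
  have "1.4 * 7.2 \<le> sqrt 2 * (pi * sqrt 3 + ln 8)"
    using A s2 by (intro mult_mono) auto
  then show "k4 \<ge> 1"
    by (simp add: k4_def)
qed

text \<open>Multiplied by \<open>b\<close> and with \<open>y = sqrt b\<close>, the left side is
  \<open>sqrt 2 * y\<close>. By \<open>C2 \<ge> 2 * b\<close> and the bounds on the constants the
  right side is at least \<open>3 / 10 + 2 / 5 * y + 4 * y ^ 3\<close>, so a cubic inequality for
  \<open>y > 0\<close> remains.\<close>

lemma density_bound_le_k_bound:
  assumes b: "b > 0" and C2: "C2 \<ge> 2 * b" and C3: "C3 \<ge> 0"
  shows "sqrt 2 / sqrt b \<le> 1 / b * (k1 + C3 * k2 + 1 / sqrt b * C2 * (k3 + C2 * k4))"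
proof -
  define y where "y = sqrt b"
  have y: "y > 0" and b_eq: "b = y\<^sup>2"
    using b by (auto simp: y_def)
  note k = k_lower_bounds
  have s2: "sqrt 2 \<le> 1.42"
    by (rule real_le_lsqrt) (simp_all add: power2_eq_square)
  have "1.42 * y \<le> 3 / 10 + 2 / 5 * y + 4 * y ^ 3"
  proof -
    \<comment> \<open>The cubic has its positive minimiser near 0.3, hence the double root there.
      The root at -0.6 cancels the quadratic term, and the linear remainder is positive.\<close>
    have "4 * y ^ 3 - 1.02 * y + 3 / 10 = 4 * (y + 0.6) * (y - 0.3)\<^sup>2 + (0.06 * y + 0.084)"
      by (simp add: power2_eq_square power3_eq_cube algebra_simps)
    also have "\<dots> \<ge> 0"
      using y by (intro add_nonneg_nonneg mult_nonneg_nonneg) auto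
    finally show ?thesis by simp
  qed
  moreover have "1 / y * C2 * (k3 + C2 * k4) \<ge> 1 / y * (2 * b) * (1 / 5 + (2 * b) * 1)"
    using k C2 b y by (intro mult_mono mult_left_mono add_mono add_nonneg_nonneg) auto
  moreover have "1 / y * (2 * b) * (1 / 5 + (2 * b) * 1) = 2 / 5 * y + 4 * y ^ 3"
    using y by (simp add: b_eq power2_eq_square power3_eq_cube field_simps)
  moreover have "C3 * k2 \<ge> 0"
    using C3 k by simp
  moreover have "sqrt 2 * y \<le> 1.42 * y"
    using s2 y by (intro mult_right_mono) auto
  ultimately have "sqrt 2 * y \<le> k1 + C3 * k2 + 1 / y * C2 * (k3 + C2 * k4)"
    using k(1) by linarith
  then have "1 / b * (sqrt 2 * y) \<le> 1 / b * (k1 + C3 * k2 + 1 / y * C2 * (k3 + C2 * k4))"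
    using b by (intro mult_left_mono) auto
  moreover have "1 / b * (sqrt 2 * y) = sqrt 2 / y"
    using y by (simp add: b_eq power2_eq_square)
  ultimately show ?thesis
    by (simp add: y_def)
qed

section \<open>Choice of the two blocks\<close>

text \<open>Take \<open>A\<close> of largest weight among the subsets carrying at most 3/4 of the
  total. If it carried less than 1/4, adding an element of positive weight, which is at most 1/2 of
  the total, would stay within 3/4 and contradict maximality.\<close>

lemma exists_balanced_subset:
  fixes w :: "'i \<Rightarrow> real"
  assumes fin: "finite I" and nonneg: "\<And>i. i \<in> I \<Longrightarrow> w i \<ge> 0"
    and half: "\<And>i. i \<in> I \<Longrightarrow> w i \<le> sum w I / 2"
  shows "\<exists>A\<subseteq>I. sum w I \<le> 4 * sum w A \<and> sum w I \<le> 4 * sum w (I - A)"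
proof -
  define F where "F = {A. A \<subseteq> I \<and> sum w A \<le> 3 / 4 * sum w I}"
  have "finite F"
    using fin by (auto simp: F_def)
  moreover have "{} \<in> F"
    using nonneg by (auto simp: F_def sum_nonneg)
  ultimately have fin_im: "finite (sum w ` F)" and "sum w ` F \<noteq> {}"
    by auto
  from Max_in[OF this] obtain A where A: "A \<in> F" "Max (sum w ` F) = sum w A"
    by auto
  have max: "sum w B \<le> sum w A" if "B \<in> F" for B
    unfolding A(2)[symmetric] using fin_im that by (intro Max_ge) auto
  from A(1) have AI: "A \<subseteq> I" and le: "sum w A \<le> 3 / 4 * sum w I"
    by (auto simp: F_def)
  have split: "sum w I = sum w A + sum w (I - A)"
    using fin AI by (simp add: sum.subset_diff)
  have "sum w I \<le> 4 * sum w A"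
  proof (rule ccontr)
    assume "\<not> sum w I \<le> 4 * sum w A"
    then have lt: "sum w A < sum w I / 4" by simp
    moreover have "sum w A \<ge> 0"
      using AI nonneg by (intro sum_nonneg) auto
    ultimately have "sum w (I - A) > 0"
      using split by simp
    then obtain k where k: "k \<in> I - A" "w k > 0"
      by (meson not_le sum_nonpos)
    have ins: "sum w (insert k A) = w k + sum w A"
      using k AI fin finite_subset by (subst sum.insert) auto
    have "insert k A \<in> F"
      unfolding F_def using k AI ins lt half[of k] by auto
    from max[OF this] show False
      using ins k by simp
  qed
  with le split AI show ?thesis
    by (intro exI[of _ A]) auto
qed

text \<open>If one coordinate of \<open>\<alpha>\<close> dominates, its block is that coordinate alone, and orthogonality makes
  the corresponding coordinate of \<open>\<beta>\<close> small; otherwise \<open>\<alpha>\<close> can be split evenly.\<close>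

lemma exists_orthogonal_split:
  fixes \<alpha> \<beta> :: "'i \<Rightarrow> real"
  defines "S \<equiv> \<lambda>v J. sqrt (\<Sum>i\<in>J. (v i)\<^sup>2)"
  assumes fin: "finite I" and orth: "(\<Sum>i\<in>I. \<alpha> i * \<beta> i) = 0"
  shows "\<exists>A u v. A \<subseteq> I \<and> u \<ge> 0 \<and> v \<ge> 0 \<and> u + v \<le> 2 * sqrt 2 * S \<beta> I \<and>
    S \<beta> A * S \<alpha> I \<le> u * S \<alpha> (I - A) \<and> S \<beta> (I - A) * S \<alpha> I \<le> v * S \<alpha> A"
proof (cases "\<forall>k\<in>I. (\<alpha> k)\<^sup>2 \<le> (\<Sum>i\<in>I. (\<alpha> i)\<^sup>2) / 2")
  case True
  then obtain A where A: "A \<subseteq> I" "(\<Sum>i\<in>I. (\<alpha> i)\<^sup>2) \<le> 4 * (\<Sum>i\<in>A. (\<alpha> i)\<^sup>2)"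
      "(\<Sum>i\<in>I. (\<alpha> i)\<^sup>2) \<le> 4 * (\<Sum>i\<in>I - A. (\<alpha> i)\<^sup>2)"
    using exists_balanced_subset[OF fin, of "\<lambda>i. (\<alpha> i)\<^sup>2"] by auto
  have S_nonneg: "S v J \<ge> 0" for v J
    by (simp add: S_def sum_nonneg)
  have "S \<alpha> I \<le> 2 * S \<alpha> (I - A)" "S \<alpha> I \<le> 2 * S \<alpha> A"
    using A(2,3)[THEN real_sqrt_le_mono] by (simp_all add: S_def real_sqrt_mult)
  then have "S \<beta> A * S \<alpha> I \<le> S \<beta> A * (2 * S \<alpha> (I - A))" "S \<beta> (I - A) * S \<alpha> I \<le> S \<beta> (I - A) * (2 * S \<alpha> A)"
    using S_nonneg by (intro mult_left_mono; simp)+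
  \<comment> \<open>The squared norms of the blocks add up to that of \<beta>, and a sum of two
    numbers is at most \<open>sqrt 2\<close> times the root of the sum of their squares.\<close>
  moreover have "2 * S \<beta> A + 2 * S \<beta> (I - A) \<le> 2 * sqrt 2 * S \<beta> I"
  proof -
    have sq: "(S v J)\<^sup>2 = (\<Sum>i\<in>J. (v i)\<^sup>2)" for v J
      by (simp add: S_def sum_nonneg)
    have "(S \<beta> I)\<^sup>2 = (S \<beta> A)\<^sup>2 + (S \<beta> (I - A))\<^sup>2"
      unfolding sq using fin A(1) by (simp add: sum.subset_diff)
    moreover have "0 \<le> (S \<beta> A - S \<beta> (I - A))\<^sup>2" by simp
    ultimately have "(S \<beta> A + S \<beta> (I - A))\<^sup>2 \<le> (sqrt 2 * S \<beta> I)\<^sup>2"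
      by (simp add: power_mult_distrib power2_diff power2_sum)
    then have "S \<beta> A + S \<beta> (I - A) \<le> sqrt 2 * S \<beta> I"
      by (rule power2_le_imp_le) (simp add: S_nonneg)
    then show ?thesis by simp
  qed
  ultimately show ?thesis
    using A(1) S_nonneg
    by (intro exI[of _ A] exI[of _ "2 * S \<beta> A"] exI[of _ "2 * S \<beta> (I - A)"]) (auto simp: mult_ac)
next
  case False
  then obtain k where k: "k \<in> I" and big: "(\<Sum>i\<in>I. (\<alpha> i)\<^sup>2) < 2 * (\<alpha> k)\<^sup>2"
    by (auto simp: not_le)
  let ?B = "I - {k}"
  have split: "sum h I = h k + sum h ?B" for h :: "'i \<Rightarrow> real"
    using fin k by (simp add: sum.remove)
  \<comment> \<open>Orthogonality expresses the product at \<open>k\<close> through the other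
    coordinates, where Cauchy-Schwarz applies. Adding \<open>(\<beta> k)\<^sup>2\<close> times the
    squared norm of \<alpha> off \<open>k\<close> to both sides gives \<open>CS\<close>.\<close>
  have "\<alpha> k * \<beta> k = - (\<Sum>i\<in>?B. \<alpha> i * \<beta> i)"
    using orth split[of "\<lambda>i. \<alpha> i * \<beta> i"] by simp
  then have "(\<alpha> k)\<^sup>2 * (\<beta> k)\<^sup>2 = (\<Sum>i\<in>?B. \<alpha> i * \<beta> i)\<^sup>2"
    by (metis power2_minus power_mult_distrib)
  also have "\<dots> \<le> (\<Sum>i\<in>?B. (\<alpha> i)\<^sup>2) * (\<Sum>i\<in>?B. (\<beta> i)\<^sup>2)"
    by (rule Cauchy_Schwarz_ineq_sum)
  finally have CS: "(\<beta> k)\<^sup>2 * (\<Sum>i\<in>I. (\<alpha> i)\<^sup>2) \<le> (\<Sum>i\<in>I. (\<beta> i)\<^sup>2) * (\<Sum>i\<in>?B. (\<alpha> i)\<^sup>2)"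
    unfolding split[of "\<lambda>i. (\<alpha> i)\<^sup>2"] split[of "\<lambda>i. (\<beta> i)\<^sup>2"] by (simp add: algebra_simps)
  have 1: "S \<beta> {k} * S \<alpha> I \<le> S \<beta> I * S \<alpha> ?B"
    using real_sqrt_le_mono[OF CS] by (simp add: S_def real_sqrt_mult)
  have "(\<Sum>i\<in>?B. (\<beta> i)\<^sup>2) * (\<Sum>i\<in>I. (\<alpha> i)\<^sup>2) \<le> (\<Sum>i\<in>I. (\<beta> i)\<^sup>2) * (2 * (\<alpha> k)\<^sup>2)"
    using big by (intro mult_mono sum_mono2 sum_nonneg) (auto simp: fin)
  from real_sqrt_le_mono[OF this] have 2: "S \<beta> ?B * S \<alpha> I \<le> (sqrt 2 * S \<beta> I) * S \<alpha> {k}"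
    by (simp add: S_def real_sqrt_mult mult_ac)
  \<comment> \<open>The witnesses will be \<open>u = S \<beta> I\<close> and
    \<open>v = sqrt 2 * S \<beta> I\<close>, so the bound on \<open>u + v\<close> reduces to
    \<open>1 \<le> sqrt 2\<close>.\<close>
  have "sqrt 2 \<ge> (1::real)" by simp
  then have "1 * S \<beta> I \<le> sqrt 2 * S \<beta> I"
    by (intro mult_right_mono) (auto simp: S_def sum_nonneg)
  then have "S \<beta> I + sqrt 2 * S \<beta> I \<le> 2 * sqrt 2 * S \<beta> I" by linarith
  with 1 2 k show ?thesis
    by (intro exI[of _ "{k}"] exI[of _ "S \<beta> I"] exI[of _ "sqrt 2 * S \<beta> I"]) (auto simp: S_def sum_nonneg)
qed

subsection \<open>Small-ball estimates for linear combinations\<close>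

text \<open>For fixed \<open>(Y, X)\<close> the event says that \<open>Z\<close> lies in an interval
  of radius \<open>e\<close> around \<open>- X\<close>, which has probability at most
  \<open>K\<close> by independence. Integrating over \<open>(Y, X)\<close> leaves the first absolute
  moment of \<open>Y\<close>.\<close>

lemma (in prob_space) small_ball_nn_integral_le:
  fixes X Y Z :: "'a \<Rightarrow> real"
  assumes ind: "indep_var (borel \<Otimes>\<^sub>M borel) (\<lambda>\<omega>. (Y \<omega>, X \<omega>)) (borel \<Otimes>\<^sub>M borel) (\<lambda>\<omega>. (W \<omega>, Z \<omega>))"
    and conc: "\<And>y. emeasure (distr M borel Z) {y - e<..<y + e} \<le> K"
  shows "(\<integral>\<^sup>+\<omega>. ennreal \<bar>Y \<omega>\<bar> * indicator {-e<..<e} (X \<omega> + Z \<omega>) \<partial>M) \<le> (\<integral>\<^sup>+\<omega>. ennreal \<bar>Y \<omega>\<bar> \<partial>M) * K"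
proof -
  let ?P = "distr M (borel \<Otimes>\<^sub>M borel) (\<lambda>\<omega>. (Y \<omega>, X \<omega>))"
  let ?Z = "distr M (borel \<Otimes>\<^sub>M borel) (\<lambda>\<omega>. (W \<omega>, Z \<omega>))"
  let ?h = "\<lambda>(p, r). ennreal \<bar>fst p\<bar> * indicator {-e<..<e} (snd p + snd r) :: ennreal"
  from ind have rv: "(\<lambda>\<omega>. (Y \<omega>, X \<omega>)) \<in> M \<rightarrow>\<^sub>M borel \<Otimes>\<^sub>M borel" "(\<lambda>\<omega>. (W \<omega>, Z \<omega>)) \<in> M \<rightarrow>\<^sub>M borel \<Otimes>\<^sub>M borel"
    and eq: "?P \<Otimes>\<^sub>M ?Z = distr M ((borel \<Otimes>\<^sub>M borel) \<Otimes>\<^sub>M (borel \<Otimes>\<^sub>M borel)) (\<lambda>\<omega>. ((Y \<omega>, X \<omega>), (W \<omega>, Z \<omega>)))"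
    by (auto simp: indep_var_distribution_eq)
  note rv[measurable]
  have [measurable]: "random_variable borel Y" "random_variable borel Z"
    using measurable_compose[OF rv(1) measurable_fst] measurable_compose[OF rv(2) measurable_snd] by simp_all
  interpret Z: prob_space ?Z
    by (rule prob_space_distr) simp
  have "(\<integral>\<^sup>+\<omega>. ennreal \<bar>Y \<omega>\<bar> * indicator {-e<..<e} (X \<omega> + Z \<omega>) \<partial>M) = (\<integral>\<^sup>+p. ?h p \<partial>(?P \<Otimes>\<^sub>M ?Z))"
    unfolding eq by (subst nn_integral_distr) auto
  also have "\<dots> = (\<integral>\<^sup>+p. \<integral>\<^sup>+r. ?h (p, r) \<partial>?Z \<partial>?P)"
    by (rule Z.nn_integral_fst[symmetric]) measurable
  also have "\<dots> \<le> (\<integral>\<^sup>+p. ennreal \<bar>fst p\<bar> * K \<partial>?P)"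
  proof (rule nn_integral_mono)
    fix p :: "real \<times> real"
    let ?S = "{- snd p - e<..<- snd p + e}"
    have "(\<integral>\<^sup>+r. ?h (p, r) \<partial>?Z) = (\<integral>\<^sup>+\<omega>. ennreal \<bar>fst p\<bar> * indicator ?S (Z \<omega>) \<partial>M)"
      by (subst nn_integral_distr) (auto intro!: nn_integral_cong split: split_indicator)
    also have "\<dots> = (\<integral>\<^sup>+z. ennreal \<bar>fst p\<bar> * indicator ?S z \<partial>distr M borel Z)"
      by (subst nn_integral_distr) auto
    also have "\<dots> = ennreal \<bar>fst p\<bar> * emeasure (distr M borel Z) ?S"
      by (rule nn_integral_cmult_indicator) simp
    also have "\<dots> \<le> ennreal \<bar>fst p\<bar> * K"
      using conc[of "- snd p"] by (intro mult_left_mono) auto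
    finally show "(\<integral>\<^sup>+r. ?h (p, r) \<partial>?Z) \<le> ennreal \<bar>fst p\<bar> * K" .
  qed
  also have "\<dots> = (\<integral>\<^sup>+\<omega>. ennreal \<bar>Y \<omega>\<bar> * K \<partial>M)"
    by (subst nn_integral_distr) auto
  also have "\<dots> = (\<integral>\<^sup>+\<omega>. ennreal \<bar>Y \<omega>\<bar> \<partial>M) * K"
    by (rule nn_integral_multc) measurable
  finally show ?thesis .
qed

section \<open>Moments, decay and small-ball bounds for linear combinations of the family\<close>

locale normalized_indep_family = prob_space +
  fixes \<eta> :: "'i \<Rightarrow> 'a \<Rightarrow> real" and I :: "'i set" and a q :: real
  assumes finite_I: "finite I"
    and indep: "indep_vars (\<lambda>_. borel) \<eta> I"
    and integrable_eta: "k \<in> I \<Longrightarrow> integrable M (\<eta> k)"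
    and mean_zero: "k \<in> I \<Longrightarrow> expectation (\<eta> k) = 0"
    and integrable_square: "k \<in> I \<Longrightarrow> integrable M (\<lambda>\<omega>. (\<eta> k \<omega>)\<^sup>2)"
    and second_moment: "k \<in> I \<Longrightarrow> expectation (\<lambda>\<omega>. (\<eta> k \<omega>)\<^sup>2) = 1"
    and a_pos: "a > 0" and q_ge_1: "q \<ge> 1"
    and decay: "k \<in> I \<Longrightarrow> cmod (char (distr M borel (\<eta> k)) s) \<le> 1 / (1 + a * s\<^sup>2) powr q"
begin

abbreviation lincomb :: "('i \<Rightarrow> real) \<Rightarrow> 'i set \<Rightarrow> 'a \<Rightarrow> real" where
  "lincomb c J \<omega> \<equiv> \<Sum>i\<in>J. c i * \<eta> i \<omega>"

lemma eta_measurable: "k \<in> I \<Longrightarrow> random_variable borel (\<eta> k)"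
  using indep by (auto simp: indep_vars_def)

lemma lincomb_measurable: "J \<subseteq> I \<Longrightarrow> random_variable borel (lincomb c J)"
  using eta_measurable by (intro borel_measurable_sum) auto

lemma indep_vars_scaled: "J \<subseteq> I \<Longrightarrow> indep_vars (\<lambda>_. borel) (\<lambda>i \<omega>. c i * \<eta> i \<omega>) J"
  by (rule indep_vars_compose2[OF indep_vars_subset[OF indep]]) auto

lemma indep_var_lincombs:
  assumes "A \<subseteq> I" "B \<subseteq> I" "A \<inter> B = {}"
  shows "indep_var (borel \<Otimes>\<^sub>M borel) (\<lambda>\<omega>. (lincomb c A \<omega>, lincomb d A \<omega>))
    (borel \<Otimes>\<^sub>M borel) (\<lambda>\<omega>. (lincomb c' B \<omega>, lincomb d' B \<omega>))"
proof -
  have "indep_var (borel \<Otimes>\<^sub>M borel)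
      ((\<lambda>f. (\<Sum>i\<in>A. c i * f i, \<Sum>i\<in>A. d i * f i)) \<circ> (\<lambda>\<omega>. restrict (\<lambda>i. \<eta> i \<omega>) A))
      (borel \<Otimes>\<^sub>M borel) ((\<lambda>f. (\<Sum>i\<in>B. c' i * f i, \<Sum>i\<in>B. d' i * f i)) \<circ> (\<lambda>\<omega>. restrict (\<lambda>i. \<eta> i \<omega>) B))"
    by (rule indep_var_compose[OF indep_var_restrict[OF indep]]) (use assms in auto)
  then show ?thesis
    by (simp add: o_def)
qed

text \<open>The four claims form a single induction: the cross term of the square vanishes by
  independence and zero means, which needs the mean and integrability claims for
  \<open>J\<close>.\<close>

lemma second_moment_lincomb:
  assumes "J \<subseteq> I"
  shows "integrable M (lincomb c J) \<and> expectation (lincomb c J) = 0 \<and>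
    integrable M (\<lambda>\<omega>. (lincomb c J \<omega>)\<^sup>2) \<and> expectation (\<lambda>\<omega>. (lincomb c J \<omega>)\<^sup>2) = (\<Sum>i\<in>J. (c i)\<^sup>2)"
proof -
  have "finite J"
    using assms finite_I finite_subset by blast
  then show ?thesis
    using assms
  proof (induction J rule: finite_induct)
    case (insert k J)
    then have k: "k \<in> I" and IH: "integrable M (lincomb c J)" "expectation (lincomb c J) = 0"
      "integrable M (\<lambda>\<omega>. (lincomb c J \<omega>)\<^sup>2)"
      "expectation (\<lambda>\<omega>. (lincomb c J \<omega>)\<^sup>2) = (\<Sum>i\<in>J. (c i)\<^sup>2)"
      by auto
    note eta = integrable_eta[OF k] mean_zero[OF k] integrable_square[OF k] second_moment[OF k]
    have "indep_var borel (\<lambda>\<omega>. c k * \<eta> k \<omega>) borel (lincomb c J)"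
      using insert by (intro indep_vars_sum indep_vars_scaled) auto
    from indep_var_integrable[OF this] indep_var_lebesgue_integral[OF this]
    have cross: "integrable M (\<lambda>\<omega>. c k * \<eta> k \<omega> * lincomb c J \<omega>)"
      "expectation (\<lambda>\<omega>. c k * \<eta> k \<omega> * lincomb c J \<omega>) = 0"
      using eta IH by auto
    have "lincomb c (insert k J) = (\<lambda>\<omega>. c k * \<eta> k \<omega> + lincomb c J \<omega>)"
      using insert.hyps by simp
    moreover have "(\<lambda>\<omega>. (c k * \<eta> k \<omega> + lincomb c J \<omega>)\<^sup>2) =
        (\<lambda>\<omega>. (c k)\<^sup>2 * (\<eta> k \<omega>)\<^sup>2 + 2 * (c k * \<eta> k \<omega> * lincomb c J \<omega>) + (lincomb c J \<omega>)\<^sup>2)"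
      by (simp add: power2_sum power_mult_distrib algebra_simps)
    moreover have "integrable M (\<lambda>\<omega>. c k * \<eta> k \<omega>)" "integrable M (\<lambda>\<omega>. (c k)\<^sup>2 * (\<eta> k \<omega>)\<^sup>2)"
      "integrable M (\<lambda>\<omega>. 2 * (c k * \<eta> k \<omega> * lincomb c J \<omega>))"
      using eta cross by simp_all
    ultimately show ?case
      using eta IH cross insert.hyps
      by (simp add: Bochner_Integration.integrable_add Bochner_Integration.integral_add del: mult.assoc)
  qed (simp add: prob_space)
qed

text \<open>Nonnegativity of the variance of the absolute value bounds the first absolute moment by
  the root of the second moment.\<close>

lemma nn_integral_abs_lincomb_le:
  assumes "J \<subseteq> I"
  shows "(\<integral>\<^sup>+\<omega>. ennreal \<bar>lincomb c J \<omega>\<bar> \<partial>M) \<le> ennreal (sqrt (\<Sum>i\<in>J. (c i)\<^sup>2))"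
proof -
  let ?Y = "\<lambda>\<omega>. \<bar>lincomb c J \<omega>\<bar>"
  note m = second_moment_lincomb[OF assms, of c]
  have "0 \<le> expectation (\<lambda>\<omega>. (?Y \<omega>)\<^sup>2) - (expectation ?Y)\<^sup>2"
    using m variance_eq[of ?Y] variance_positive[of ?Y] by simp
  then have "(expectation ?Y)\<^sup>2 \<le> (\<Sum>i\<in>J. (c i)\<^sup>2)"
    using m by simp
  then have "expectation ?Y \<le> sqrt (\<Sum>i\<in>J. (c i)\<^sup>2)"
    by (rule real_le_rsqrt)
  then show ?thesis
    using m by (subst nn_integral_eq_integral) (auto intro!: ennreal_leI)
qed

lemma char_scaled: "k \<in> I \<Longrightarrow> char (distr M borel (\<lambda>\<omega>. c * \<eta> k \<omega>)) t = char (distr M borel (\<eta> k)) (c * t)"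
  using eta_measurable[of k] by (simp add: char_def integral_distr mult_ac)

text \<open>By independence the decay factors multiply. Keeping only the constant and linear terms
  of the product of the \<open>1 + a * (c i * t)\<^sup>2\<close>, and then Bernoulli for the
  exponent \<open>q\<close>, leaves one quadratic.\<close>

lemma char_lincomb_decay:
  assumes J: "J \<subseteq> I"
  shows "cmod (char (distr M borel (lincomb c J)) t) \<le> 1 / (1 + a * q * (\<Sum>i\<in>J. (c i)\<^sup>2) * t\<^sup>2)"
proof -
  let ?s = "\<Sum>i\<in>J. (c i)\<^sup>2"
  have nn: "a * (c i * t)\<^sup>2 \<ge> 0" for i
    using a_pos by simp
  have pos: "1 + a * (c i * t)\<^sup>2 > 0" for i
    using nn[of i] by simp
  have "char (distr M borel (lincomb c J)) t = (\<Prod>i\<in>J. char (distr M borel (\<eta> i)) (c i * t))"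
    using char_distr_sum[OF indep_vars_scaled[OF J]] char_scaled J by (simp add: subset_iff)
  then have "cmod (char (distr M borel (lincomb c J)) t) \<le> (\<Prod>i\<in>J. 1 / (1 + a * (c i * t)\<^sup>2) powr q)"
    unfolding prod_norm[symmetric] using decay J by (auto simp: prod_norm[symmetric] intro!: prod_mono)
  also have "\<dots> = 1 / (\<Prod>i\<in>J. 1 + a * (c i * t)\<^sup>2) powr q"
    using pos by (simp add: prod_dividef prod_powr_distrib less_imp_le)
  also have "\<dots> \<le> 1 / (1 + a * q * ?s * t\<^sup>2)"
  proof (rule divide_left_mono)
    have "1 + a * ?s * t\<^sup>2 = 1 + (\<Sum>i\<in>J. a * (c i * t)\<^sup>2)"
      by (simp add: sum_distrib_left sum_distrib_right power_mult_distrib mult_ac)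
    also have "\<dots> \<le> (\<Prod>i\<in>J. 1 + a * (c i * t)\<^sup>2)"
      using nn by (rule one_plus_sum_le_prod)
    finally have le: "1 + a * ?s * t\<^sup>2 \<le> (\<Prod>i\<in>J. 1 + a * (c i * t)\<^sup>2)" .
    have nn': "a * ?s * t\<^sup>2 \<ge> 0"
      using a_pos by (intro mult_nonneg_nonneg sum_nonneg) auto
    have "1 + q * (a * ?s * t\<^sup>2) \<le> (1 + a * ?s * t\<^sup>2) powr q"
      using nn' q_ge_1 by (rule Bernoulli_inequality_powr)
    also have "\<dots> \<le> (\<Prod>i\<in>J. 1 + a * (c i * t)\<^sup>2) powr q"
      using nn' q_ge_1 by (intro powr_mono2 le) auto
    finally show *: "1 + a * q * ?s * t\<^sup>2 \<le> (\<Prod>i\<in>J. 1 + a * (c i * t)\<^sup>2) powr q"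
      by (simp add: mult_ac)
    have "q * (a * ?s * t\<^sup>2) \<ge> 0"
      using nn' q_ge_1 by simp
    then have "1 + a * q * ?s * t\<^sup>2 > 0"
      by (simp add: mult_ac)
    with * show "0 < (\<Prod>i\<in>J. 1 + a * (c i * t)\<^sup>2) powr q * (1 + a * q * ?s * t\<^sup>2)"
      by (intro mult_pos_pos) auto
  qed simp
  finally show ?thesis .
qed

text \<open>The \<beta>-part on \<open>A\<close> is paired with the \<alpha>-part on the complement,
  which is independent of it and spreads the sum out. Writing the condition on \<open>u\<close> as a
  product instead of a quotient admits a vanishing \<alpha>-part.\<close>

lemma small_ball_block_le:
  assumes A: "A \<subseteq> I" and e: "e > 0" and u: "u \<ge> 0"
    and pos: "sqrt (\<Sum>i\<in>I. (\<alpha> i)\<^sup>2) > 0"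
    and le: "sqrt (\<Sum>i\<in>A. (\<beta> i)\<^sup>2) * sqrt (\<Sum>i\<in>I. (\<alpha> i)\<^sup>2) \<le> u * sqrt (\<Sum>i\<in>I - A. (\<alpha> i)\<^sup>2)"
  shows "(\<integral>\<^sup>+\<omega>. ennreal \<bar>lincomb \<beta> A \<omega>\<bar> * indicator {-e<..<e} (lincomb \<alpha> I \<omega>) \<partial>M)
    \<le> ennreal (u * e / (sqrt (a * q) * sqrt (\<Sum>i\<in>I. (\<alpha> i)\<^sup>2)))"
\<comment> \<open>If \<alpha> vanishes on the complement there is no spreading, but then
  \<open>le\<close> forces \<beta> to vanish on \<open>A\<close> and the integral is 0.\<close>
proof (cases "(\<Sum>i\<in>I - A. (\<alpha> i)\<^sup>2) = 0")
  case True
  with le have "sqrt (\<Sum>i\<in>A. (\<beta> i)\<^sup>2) * sqrt (\<Sum>i\<in>I. (\<alpha> i)\<^sup>2) \<le> 0"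
    by simp
  with pos have "sqrt (\<Sum>i\<in>A. (\<beta> i)\<^sup>2) \<le> 0"
    by (simp only: mult_le_0_iff) linarith
  then have "(\<integral>\<^sup>+\<omega>. ennreal \<bar>lincomb \<beta> A \<omega>\<bar> \<partial>M) = 0"
    using nn_integral_abs_lincomb_le[OF A, of \<beta>] by (simp add: ennreal_neg)
  moreover have "(\<integral>\<^sup>+\<omega>. ennreal \<bar>lincomb \<beta> A \<omega>\<bar> * indicator {-e<..<e} (lincomb \<alpha> I \<omega>) \<partial>M)
      \<le> (\<integral>\<^sup>+\<omega>. ennreal \<bar>lincomb \<beta> A \<omega>\<bar> \<partial>M)"
    by (intro nn_integral_mono) (auto split: split_indicator)
  ultimately show ?thesis by simp
next
  case False
  let ?sB = "\<Sum>i\<in>I - A. (\<alpha> i)\<^sup>2"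
  have sB: "?sB > 0"
    using False sum_nonneg[of "I - A" "\<lambda>i. (\<alpha> i)\<^sup>2"] by simp
  have aq: "a * q > 0"
    using a_pos q_ge_1 by simp
  interpret B: real_distribution "distr M borel (lincomb \<alpha> (I - A))"
    by (rule real_distribution_distr) (rule lincomb_measurable, simp)
  have split: "lincomb \<alpha> I \<omega> = lincomb \<alpha> A \<omega> + lincomb \<alpha> (I - A) \<omega>" for \<omega>
    using finite_I A by (simp add: sum.subset_diff)
  have "(\<integral>\<^sup>+\<omega>. ennreal \<bar>lincomb \<beta> A \<omega>\<bar> * indicator {-e<..<e} (lincomb \<alpha> I \<omega>) \<partial>M)
      \<le> (\<integral>\<^sup>+\<omega>. ennreal \<bar>lincomb \<beta> A \<omega>\<bar> \<partial>M) * ennreal (e / sqrt (a * q * ?sB))"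
    unfolding split
  proof (rule small_ball_nn_integral_le)
    show "indep_var (borel \<Otimes>\<^sub>M borel) (\<lambda>\<omega>. (lincomb \<beta> A \<omega>, lincomb \<alpha> A \<omega>))
        (borel \<Otimes>\<^sub>M borel) (\<lambda>\<omega>. (lincomb \<alpha> (I - A) \<omega>, lincomb \<alpha> (I - A) \<omega>))"
      using A by (intro indep_var_lincombs) auto
    show "emeasure (distr M borel (lincomb \<alpha> (I - A))) {y - e<..<y + e} \<le> ennreal (e / sqrt (a * q * ?sB))" for y
      using aq sB e by (intro B.emeasure_Ioo_le_if_quadratic_decay char_lincomb_decay) auto
  qed
  also have "\<dots> \<le> ennreal (sqrt (\<Sum>i\<in>A. (\<beta> i)\<^sup>2)) * ennreal (e / sqrt (a * q * ?sB))"
    by (intro mult_right_mono nn_integral_abs_lincomb_le A) simp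
  also have "\<dots> = ennreal (sqrt (\<Sum>i\<in>A. (\<beta> i)\<^sup>2) * (e / sqrt (a * q * ?sB)))"
    using e aq sB by (intro ennreal_mult[symmetric]) (auto simp: sum_nonneg)
  also have "\<dots> \<le> ennreal (u * e / (sqrt (a * q) * sqrt (\<Sum>i\<in>I. (\<alpha> i)\<^sup>2)))"
  proof (rule ennreal_leI)
    have "sqrt (\<Sum>i\<in>A. (\<beta> i)\<^sup>2) / sqrt ?sB \<le> u / sqrt (\<Sum>i\<in>I. (\<alpha> i)\<^sup>2)"
      using le pos sB by (simp add: divide_simps mult_ac)
    then have "e / sqrt (a * q) * (sqrt (\<Sum>i\<in>A. (\<beta> i)\<^sup>2) / sqrt ?sB)
        \<le> e / sqrt (a * q) * (u / sqrt (\<Sum>i\<in>I. (\<alpha> i)\<^sup>2))"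
      using e aq by (intro mult_left_mono) auto
    then show "sqrt (\<Sum>i\<in>A. (\<beta> i)\<^sup>2) * (e / sqrt (a * q * ?sB))
        \<le> u * e / (sqrt (a * q) * sqrt (\<Sum>i\<in>I. (\<alpha> i)\<^sup>2))"
      by (simp add: real_sqrt_mult mult_ac)
  qed
  finally show ?thesis .
qed

lemma small_ball_le:
  assumes e: "e > 0" and pos: "(\<Sum>i\<in>I. (\<alpha> i)\<^sup>2) > 0" and orth: "(\<Sum>i\<in>I. \<alpha> i * \<beta> i) = 0"
  shows "(\<integral>\<^sup>+\<omega>. ennreal \<bar>lincomb \<beta> I \<omega>\<bar> * indicator {-e<..<e} (lincomb \<alpha> I \<omega>) \<partial>M)
    \<le> ennreal (2 * e * (sqrt 2 / sqrt (a * q) * (sqrt (\<Sum>i\<in>I. (\<beta> i)\<^sup>2) / sqrt (\<Sum>i\<in>I. (\<alpha> i)\<^sup>2))))"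
proof -
  let ?b = "sqrt (\<Sum>i\<in>I. (\<beta> i)\<^sup>2)" and ?a = "sqrt (\<Sum>i\<in>I. (\<alpha> i)\<^sup>2)"
  obtain A u v where A: "A \<subseteq> I" and uv: "u \<ge> 0" "v \<ge> 0" "u + v \<le> 2 * sqrt 2 * ?b"
    and u: "sqrt (\<Sum>i\<in>A. (\<beta> i)\<^sup>2) * ?a \<le> u * sqrt (\<Sum>i\<in>I - A. (\<alpha> i)\<^sup>2)"
    and v: "sqrt (\<Sum>i\<in>I - A. (\<beta> i)\<^sup>2) * ?a \<le> v * sqrt (\<Sum>i\<in>A. (\<alpha> i)\<^sup>2)"
    using exists_orthogonal_split[OF finite_I orth] by blast
  have [measurable]: "random_variable borel (lincomb c A)" "random_variable borel (lincomb c (I - A))"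
    "random_variable borel (lincomb c I)" for c
    using A by (auto intro!: lincomb_measurable)
  have aq: "a * q > 0"
    using a_pos q_ge_1 by simp
  have apos: "?a > 0"
    using pos by simp
  have IA: "I - (I - A) = A"
    using A by auto
  have split: "lincomb \<beta> I \<omega> = lincomb \<beta> A \<omega> + lincomb \<beta> (I - A) \<omega>" for \<omega>
    using finite_I A by (simp add: sum.subset_diff)
  have "(\<integral>\<^sup>+\<omega>. ennreal \<bar>lincomb \<beta> I \<omega>\<bar> * indicator {-e<..<e} (lincomb \<alpha> I \<omega>) \<partial>M)
      \<le> (\<integral>\<^sup>+\<omega>. ennreal \<bar>lincomb \<beta> A \<omega>\<bar> * indicator {-e<..<e} (lincomb \<alpha> I \<omega>)
           + ennreal \<bar>lincomb \<beta> (I - A) \<omega>\<bar> * indicator {-e<..<e} (lincomb \<alpha> I \<omega>) \<partial>M)"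
    unfolding split[of _] distrib_right[symmetric]
    by (intro nn_integral_mono mult_right_mono) (auto simp flip: ennreal_plus intro!: ennreal_leI abs_triangle_ineq)
  also have "\<dots> = (\<integral>\<^sup>+\<omega>. ennreal \<bar>lincomb \<beta> A \<omega>\<bar> * indicator {-e<..<e} (lincomb \<alpha> I \<omega>) \<partial>M)
      + (\<integral>\<^sup>+\<omega>. ennreal \<bar>lincomb \<beta> (I - A) \<omega>\<bar> * indicator {-e<..<e} (lincomb \<alpha> I \<omega>) \<partial>M)"
    by (rule nn_integral_add) measurable
  \<comment> \<open>The second term is the block estimate with \<open>I - A\<close> in place of
    \<open>A\<close>, so the roles of the two blocks are exchanged.\<close>
  also have "\<dots> \<le> ennreal (u * e / (sqrt (a * q) * ?a)) + ennreal (v * e / (sqrt (a * q) * ?a))"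
    using u v uv A e apos by (intro add_mono small_ball_block_le) (auto simp: IA)
  also have "\<dots> = ennreal ((u + v) * e / (sqrt (a * q) * ?a))"
    using uv e apos aq by (subst ennreal_plus[symmetric]) (auto simp: add_divide_distrib distrib_right)
  also have "\<dots> \<le> ennreal ((2 * sqrt 2 * ?b) * e / (sqrt (a * q) * ?a))"
    using uv(3) e apos aq by (intro ennreal_leI divide_right_mono mult_right_mono) auto
  finally show ?thesis
    by (simp add: mult_ac)
qed

end

subsection \<open>The joint density\<close>

text \<open>Two one-dimensional substitutions: the second coordinate is scaled by
  \<open>?D / a\<close> with the first one fixed, then the first is scaled by \<open>a\<close>. The
  scale factors multiply to the determinant.\<close>

lemma nn_integral_affine_plane:
  fixes F :: "real \<times> real \<Rightarrow> ennreal" and a b c d r1 r2 :: real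
  assumes F[measurable]: "F \<in> borel_measurable borel" and a: "a \<noteq> 0" and det: "a * d - b * c \<noteq> 0"
  shows "(\<integral>\<^sup>+z. F z \<partial>lborel) = ennreal \<bar>a * d - b * c\<bar> *
    (\<integral>\<^sup>+v. F (a * fst v + c * snd v + r1, b * fst v + d * snd v + r2) \<partial>lborel)"
proof -
  let ?D = "a * d - b * c"
  have [measurable]: "F \<in> borel_measurable (borel \<Otimes>\<^sub>M borel)"
    using F by (simp add: borel_prod)
  have "(\<integral>\<^sup>+z. F z \<partial>lborel) = (\<integral>\<^sup>+z1. \<integral>\<^sup>+z2. F (z1, z2) \<partial>lborel \<partial>lborel)"
    unfolding lborel_prod[symmetric] by (rule lborel.nn_integral_fst[symmetric]) measurable
  also have "\<dots> = (\<integral>\<^sup>+z1. ennreal \<bar>?D / a\<bar> *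
      (\<integral>\<^sup>+y. F (z1, (b * (z1 - r1) / a + r2) + (?D / a) * y) \<partial>lborel) \<partial>lborel)"
    using a det by (intro nn_integral_cong nn_integral_real_affine) auto
  also have "\<dots> = ennreal \<bar>?D / a\<bar> *
      (\<integral>\<^sup>+z1. \<integral>\<^sup>+y. F (z1, (b * (z1 - r1) / a + r2) + (?D / a) * y) \<partial>lborel \<partial>lborel)"
    by (intro nn_integral_cmult) measurable
  also have "(\<integral>\<^sup>+z1. \<integral>\<^sup>+y. F (z1, (b * (z1 - r1) / a + r2) + (?D / a) * y) \<partial>lborel \<partial>lborel)
      = (\<integral>\<^sup>+y. \<integral>\<^sup>+z1. F (z1, (b * (z1 - r1) / a + r2) + (?D / a) * y) \<partial>lborel \<partial>lborel)"
    by (rule lborel_pair.Fubini'[symmetric]) measurable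
  also have "\<dots> = (\<integral>\<^sup>+y. ennreal \<bar>a\<bar> * (\<integral>\<^sup>+x. F ((c * y + r1) + a * x,
      (b * ((c * y + r1) + a * x - r1) / a + r2) + (?D / a) * y) \<partial>lborel) \<partial>lborel)"
    using a by (intro nn_integral_cong nn_integral_real_affine) auto
  also have "\<dots> = ennreal \<bar>a\<bar> * (\<integral>\<^sup>+y. \<integral>\<^sup>+x. F ((c * y + r1) + a * x,
      (b * ((c * y + r1) + a * x - r1) / a + r2) + (?D / a) * y) \<partial>lborel \<partial>lborel)"
    by (intro nn_integral_cmult) measurable
  also have "(\<integral>\<^sup>+y. \<integral>\<^sup>+x. F ((c * y + r1) + a * x,
      (b * ((c * y + r1) + a * x - r1) / a + r2) + (?D / a) * y) \<partial>lborel \<partial>lborel)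
      = (\<integral>\<^sup>+y. \<integral>\<^sup>+x. F (a * x + c * y + r1, b * x + d * y + r2) \<partial>lborel \<partial>lborel)"
    using a by (intro nn_integral_cong arg_cong[of _ _ F]) (simp add: field_simps)
  also have "\<dots> = (\<integral>\<^sup>+v. F (a * fst v + c * snd v + r1, b * fst v + d * snd v + r2) \<partial>(lborel \<Otimes>\<^sub>M lborel))"
    by (subst lborel_pair.nn_integral_snd[symmetric]) (auto simp: split_beta)
  finally show ?thesis
    using a by (simp add: lborel_prod mult.assoc[symmetric] abs_mult flip: ennreal_mult)
qed

context normalized_indep_family
begin

lemma eta_continuous_density:
  assumes k: "k \<in> I"
  obtains p B where "continuous_on UNIV p" "\<And>x. 0 \<le> p x" "\<And>x. p x \<le> B"
    "distributed M lborel (\<eta> k) (\<lambda>x. ennreal (p x))"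
proof -
  interpret D: real_distribution "distr M borel (\<eta> k)"
    using eta_measurable[OF k] by (rule real_distribution_distr)
  have aq: "a * q > 0"
    using a_pos q_ge_1 by simp
  have dec: "cmod (char (distr M borel (\<eta> k)) t) \<le> 1 / (1 + a * q * t\<^sup>2)" for t
    using char_lincomb_decay[of "{k}" "\<lambda>_. 1" t] k by simp
  note int = D.integrable_char_if_quadratic_decay[OF aq dec]
  show thesis
  proof (rule that[of D.char_density])
    show "continuous_on UNIV D.char_density"
      using D.continuous_char_density[OF int] continuous_at_imp_continuous_on by blast
    show "distributed M lborel (\<eta> k) (\<lambda>x. ennreal (D.char_density x))"
      unfolding distributed_def
      using eta_measurable[OF k] D.char_density_measurable[OF int] D.eq_density_char_density[OF int]
      by (auto cong: distr_cong)
  qed (use D.char_density_nonneg[OF int] D.char_density_le_if_quadratic_decay[OF aq dec] in auto)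
qed

text \<open>The pair is an invertible linear image of \<open>(\<eta> i, \<eta> j)\<close> plus an
  independent remainder \<open>R\<close>. The image has a bounded continuous density
  \<open>G\<close>, and averaging its translates over \<open>R\<close> keeps continuity by dominated
  convergence. Such existence makes the choice in \<open>joint_density\<close> meaningful.\<close>

lemma exists_continuous_joint_density_aux:
  assumes ij: "i \<in> I" "j \<in> I" and \<alpha>i: "\<alpha> i \<noteq> 0" and det: "\<alpha> i * \<beta> j - \<beta> i * \<alpha> j \<noteq> 0"
  shows "\<exists>D. continuous_on UNIV D \<and> (\<forall>z. 0 \<le> D z) \<and>
    distributed M lborel (\<lambda>\<omega>. (lincomb \<alpha> I \<omega>, lincomb \<beta> I \<omega>)) (\<lambda>z. ennreal (D z))"
proof -
  obtain p Bp where p: "continuous_on UNIV p" "\<And>x. 0 \<le> p x" "\<And>x. p x \<le> Bp"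
      "distributed M lborel (\<eta> i) (\<lambda>x. ennreal (p x))"
    using eta_continuous_density[OF ij(1)] by blast
  obtain r Br where r: "continuous_on UNIV r" "\<And>x. 0 \<le> r x" "\<And>x. r x \<le> Br"
      "distributed M lborel (\<eta> j) (\<lambda>x. ennreal (r x))"
    using eta_continuous_density[OF ij(2)] by blast
  have neq: "i \<noteq> j"
    using det by auto
  define K where "K = I - {i, j}"
  define \<delta> where "\<delta> = \<alpha> i * \<beta> j - \<beta> i * \<alpha> j"
  define V where "V = (\<lambda>\<omega>. (\<eta> i \<omega>, \<eta> j \<omega>))"
  define R where "R = (\<lambda>\<omega>. (lincomb \<alpha> K \<omega>, lincomb \<beta> K \<omega>))"
  define T where "T = (\<lambda>(v::real \<times> real, w::real \<times> real).
    (\<alpha> i * fst v + \<alpha> j * snd v + fst w, \<beta> i * fst v + \<beta> j * snd v + snd w))"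
  \<comment> \<open>Density of the linear image: the product density at the preimage, given by
    Cramer's rule, divided by the Jacobian.\<close>
  define G where "G = (\<lambda>w::real \<times> real. p ((\<beta> j * fst w - \<alpha> j * snd w) / \<delta>) * r ((\<alpha> i * snd w - \<beta> i * fst w) / \<delta>) / \<bar>\<delta>\<bar>)"
  \<comment> \<open>The convolution of \<open>G\<close> with the law of \<open>R\<close>, written as
    an expectation because \<open>R\<close> may have no density.\<close>
  define D where "D = (\<lambda>z. expectation (\<lambda>\<omega>. G (z - R \<omega>)))"
  have \<delta>: "\<delta> \<noteq> 0"
    using det by (simp add: \<delta>_def)
  have G_cont: "continuous_on UNIV G"
    unfolding G_def using \<delta>
    by (intro continuous_intros continuous_on_compose2[OF p(1)] continuous_on_compose2[OF r(1)]) auto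
  have G_nonneg: "0 \<le> G w" for w
    using p(2) r(2) by (simp add: G_def)
  define BG where "BG = Bp * Br / \<bar>\<delta>\<bar>"
  have G_le: "G w \<le> BG" for w
    unfolding G_def BG_def using p(2,3) r(2,3) order_trans[OF p(2,3)]
    by (intro divide_right_mono mult_mono) auto
  have G_meas[measurable]: "G \<in> borel_measurable (borel \<Otimes>\<^sub>M borel)"
    using borel_measurable_continuous_onI[OF G_cont] by (simp add: borel_prod)
  have [measurable]: "p \<in> borel_measurable borel" "r \<in> borel_measurable borel"
    using p(1) r(1) by (auto intro: borel_measurable_continuous_onI)
  have [measurable]: "R \<in> M \<rightarrow>\<^sub>M borel \<Otimes>\<^sub>M borel" "V \<in> M \<rightarrow>\<^sub>M borel \<Otimes>\<^sub>M borel"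
    unfolding R_def V_def K_def using eta_measurable ij by (auto intro!: measurable_Pair lincomb_measurable)
  have T_meas[measurable]: "T \<in> (borel \<Otimes>\<^sub>M borel) \<Otimes>\<^sub>M (borel \<Otimes>\<^sub>M borel) \<rightarrow>\<^sub>M borel \<Otimes>\<^sub>M borel"
    unfolding T_def by measurable
  have G_int: "integrable M (\<lambda>\<omega>. G (z - R \<omega>))" for z
  proof (rule integrable_const_bound[of _ BG])
    show "(\<lambda>\<omega>. G (z - R \<omega>)) \<in> borel_measurable M"
      unfolding minus_prod_def by measurable
  qed (use G_nonneg G_le in auto)
  have split: "(lincomb \<alpha> I \<omega>, lincomb \<beta> I \<omega>) = T (V \<omega>, R \<omega>)" for \<omega>
  proof -
    have "(\<Sum>k\<in>I. h k) = h i + h j + (\<Sum>k\<in>K. h k)" for h :: "'i \<Rightarrow> real"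
      using sum.subset_diff[of "{i, j}" I h] finite_I ij neq by (simp add: K_def)
    then show ?thesis
      by (simp add: T_def V_def R_def)
  qed
  have indVR: "distr M (borel \<Otimes>\<^sub>M borel) V \<Otimes>\<^sub>M distr M (borel \<Otimes>\<^sub>M borel) R =
      distr M ((borel \<Otimes>\<^sub>M borel) \<Otimes>\<^sub>M (borel \<Otimes>\<^sub>M borel)) (\<lambda>\<omega>. (V \<omega>, R \<omega>))"
  proof -
    have "indep_var (borel \<Otimes>\<^sub>M borel) ((\<lambda>f. (f i, f j)) \<circ> (\<lambda>\<omega>. restrict (\<lambda>k. \<eta> k \<omega>) {i, j}))
        (borel \<Otimes>\<^sub>M borel) ((\<lambda>f. (\<Sum>k\<in>K. \<alpha> k * f k, \<Sum>k\<in>K. \<beta> k * f k)) \<circ> (\<lambda>\<omega>. restrict (\<lambda>k. \<eta> k \<omega>) K))"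
      by (rule indep_var_compose[OF indep_var_restrict[OF indep]]) (use ij in \<open>auto simp: K_def\<close>)
    then have "indep_var (borel \<Otimes>\<^sub>M borel) V (borel \<Otimes>\<^sub>M borel) R"
      by (simp add: o_def V_def R_def)
    then show ?thesis
      by (simp add: indep_var_distribution_eq)
  qed
  have V_dens: "distr M (borel \<Otimes>\<^sub>M borel) V = density lborel (\<lambda>v. ennreal (p (fst v)) * ennreal (r (snd v)))"
  proof -
    have "indep_var borel ((\<lambda>f. f i) \<circ> (\<lambda>\<omega>. restrict (\<lambda>k. \<eta> k \<omega>) {i}))
        borel ((\<lambda>f. f j) \<circ> (\<lambda>\<omega>. restrict (\<lambda>k. \<eta> k \<omega>) {j}))"
      by (rule indep_var_compose[OF indep_var_restrict[OF indep]]) (use ij neq in auto)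
    then have "indep_var borel (\<eta> i) borel (\<eta> j)"
      by (simp add: o_def)
    then have "indep_var lborel (\<eta> i) lborel (\<eta> j)"
      unfolding indep_var_distribution_eq by (simp cong: distr_cong sets_pair_measure_cong)
    from distributed_joint_indep[OF _ _ p(4) r(4) this]
    have "distributed M (lborel \<Otimes>\<^sub>M lborel) V (\<lambda>(x, y). ennreal (p x) * ennreal (r y))"
      by (simp add: V_def lborel.sigma_finite_measure_axioms)
    then have "distr M (lborel \<Otimes>\<^sub>M lborel) V = density (lborel \<Otimes>\<^sub>M lborel) (\<lambda>(x, y). ennreal (p x) * ennreal (r y))"
      by (simp add: distributed_def)
    then show ?thesis
      by (simp add: lborel_prod case_prod_beta' borel_prod cong: distr_cong)
  qed
  have D_nonneg: "0 \<le> D z" for z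
    by (simp add: D_def G_nonneg)
  have D_cont: "continuous_on UNIV D"
  proof (rule continuous_at_imp_continuous_on, rule ballI)
    fix z
    show "isCont D z"
      unfolding continuous_at_sequentially
    proof safe
      fix X assume X: "X \<longlonglongrightarrow> z"
      have "(\<lambda>n. expectation (\<lambda>\<omega>. G (X n - R \<omega>))) \<longlonglongrightarrow> expectation (\<lambda>\<omega>. G (z - R \<omega>))"
      proof (rule integral_dominated_convergence[where w="\<lambda>_. BG"])
        show "AE \<omega> in M. (\<lambda>n. G (X n - R \<omega>)) \<longlonglongrightarrow> G (z - R \<omega>)"
          by (intro AE_I2 continuous_on_tendsto_compose[OF G_cont] tendsto_intros X) auto
      qed (use G_int[THEN borel_measurable_integrable] G_nonneg G_le in auto)
      then show "(D \<circ> X) \<longlonglongrightarrow> D z"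
        by (simp add: D_def o_def)
    qed
  qed
  have D_meas: "D \<in> borel_measurable borel"
    by (rule borel_measurable_continuous_onI[OF D_cont])
  \<comment> \<open>With the remainder frozen at \<open>w\<close>, this is the change of variables
    for the linear image translated by \<open>w\<close>.\<close>
  have inner: "(\<integral>\<^sup>+v. indicator S (T (v, w)) \<partial>distr M (borel \<Otimes>\<^sub>M borel) V) =
      (\<integral>\<^sup>+z. ennreal (G (z - w)) * indicator S z \<partial>lborel)"
    if S: "S \<in> sets borel" for S w
  proof -
    have [measurable]: "S \<in> sets (borel \<Otimes>\<^sub>M borel)"
      using S unfolding borel_prod .
    have Gw: "(\<lambda>z. ennreal (G (z - w)) * indicator S z) \<in> borel_measurable borel"
      unfolding borel_prod[symmetric] minus_prod_def by measurable
    have [measurable]: "(\<lambda>v. T (v, w)) \<in> borel \<Otimes>\<^sub>M borel \<rightarrow>\<^sub>M borel \<Otimes>\<^sub>M borel"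
      unfolding T_def prod.case by measurable
    have GT: "G (T (v, w) - w) = p (fst v) * r (snd v) / \<bar>\<delta>\<bar>" for v
    proof -
      have "\<beta> j * (\<alpha> i * fst v + \<alpha> j * snd v) - \<alpha> j * (\<beta> i * fst v + \<beta> j * snd v) = \<delta> * fst v"
        and "\<alpha> i * (\<beta> i * fst v + \<beta> j * snd v) - \<beta> i * (\<alpha> i * fst v + \<alpha> j * snd v) = \<delta> * snd v"
        by (simp_all add: \<delta>_def algebra_simps)
      then show ?thesis
        using \<delta> by (simp add: G_def T_def minus_prod_def)
    qed
    have "(\<integral>\<^sup>+z. ennreal (G (z - w)) * indicator S z \<partial>lborel) =
        ennreal \<bar>\<delta>\<bar> * (\<integral>\<^sup>+v. ennreal (G (T (v, w) - w)) * indicator S (T (v, w)) \<partial>lborel)"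
      unfolding \<delta>_def T_def prod.case
      by (rule nn_integral_affine_plane[OF Gw \<alpha>i det])
    also have "\<dots> = (\<integral>\<^sup>+v. ennreal \<bar>\<delta>\<bar> * (ennreal (G (T (v, w) - w)) * indicator S (T (v, w))) \<partial>lborel)"
    proof (rule nn_integral_cmult[symmetric])
      show "(\<lambda>v. ennreal (G (T (v, w) - w)) * indicator S (T (v, w))) \<in> borel_measurable lborel"
        unfolding GT measurable_lborel2 borel_prod[symmetric] by measurable
    qed
    also have "\<dots> = (\<integral>\<^sup>+v. (ennreal (p (fst v)) * ennreal (r (snd v))) * indicator S (T (v, w)) \<partial>lborel)"
      using \<delta> p(2) r(2) unfolding GT
      by (intro nn_integral_cong) (simp add: mult.assoc[symmetric] flip: ennreal_mult)
    also have "\<dots> = (\<integral>\<^sup>+v. indicator S (T (v, w)) \<partial>distr M (borel \<Otimes>\<^sub>M borel) V)"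
      unfolding V_dens
    proof (rule nn_integral_density[symmetric])
      show "(\<lambda>v. ennreal (p (fst v)) * ennreal (r (snd v))) \<in> borel_measurable (lborel :: (real \<times> real) measure)"
        "(\<lambda>v. indicator S (T (v, w)) :: ennreal) \<in> borel_measurable lborel"
        unfolding measurable_lborel2 borel_prod[symmetric] by measurable
    qed
    finally show ?thesis ..
  qed
  have "distr M lborel (\<lambda>\<omega>. (lincomb \<alpha> I \<omega>, lincomb \<beta> I \<omega>)) = density lborel (\<lambda>z. ennreal (D z))"
  proof (rule measure_eqI)
    fix S assume "S \<in> sets (distr M lborel (\<lambda>\<omega>. (lincomb \<alpha> I \<omega>, lincomb \<beta> I \<omega>)))"
    then have S: "S \<in> sets borel" by simp
    have S'[measurable]: "S \<in> sets (borel \<Otimes>\<^sub>M borel)"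
      using S unfolding borel_prod .
    interpret V: prob_space "distr M (borel \<Otimes>\<^sub>M borel) V"
      by (rule prob_space_distr) simp
    interpret R: prob_space "distr M (borel \<Otimes>\<^sub>M borel) R"
      by (rule prob_space_distr) simp
    interpret VR: pair_sigma_finite "distr M (borel \<Otimes>\<^sub>M borel) V" "distr M (borel \<Otimes>\<^sub>M borel) R"
      by standard
    interpret PL: pair_sigma_finite M "lborel :: (real \<times> real) measure"
      by standard
    have TVR: "(\<lambda>\<omega>. T (V \<omega>, R \<omega>)) \<in> M \<rightarrow>\<^sub>M borel"
      unfolding borel_prod[symmetric] by measurable
    \<comment> \<open>Independence allows \<open>inner\<close> to be integrated over the law of
      \<open>R\<close>, and Tonelli then moves the expectation inside to form
      \<open>D\<close>.\<close>
    have "emeasure (distr M lborel (\<lambda>\<omega>. (lincomb \<alpha> I \<omega>, lincomb \<beta> I \<omega>))) S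
        = (\<integral>\<^sup>+z. indicator S z \<partial>distr M lborel (\<lambda>\<omega>. T (V \<omega>, R \<omega>)))"
      unfolding split using S by (subst nn_integral_indicator) auto
    also have "\<dots> = (\<integral>\<^sup>+\<omega>. indicator S (T (V \<omega>, R \<omega>)) \<partial>M)"
      using TVR S by (subst nn_integral_distr) auto
    also have "\<dots> = (\<integral>\<^sup>+u. indicator S (T u) \<partial>(distr M (borel \<Otimes>\<^sub>M borel) V \<Otimes>\<^sub>M distr M (borel \<Otimes>\<^sub>M borel) R))"
      unfolding indVR by (subst nn_integral_distr) auto
    also have "\<dots> = (\<integral>\<^sup>+w. \<integral>\<^sup>+v. indicator S (T (v, w)) \<partial>distr M (borel \<Otimes>\<^sub>M borel) V \<partial>distr M (borel \<Otimes>\<^sub>M borel) R)"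
      by (rule VR.nn_integral_snd[symmetric]) measurable
    also have "\<dots> = (\<integral>\<^sup>+w. \<integral>\<^sup>+z. ennreal (G (z - w)) * indicator S z \<partial>lborel \<partial>distr M (borel \<Otimes>\<^sub>M borel) R)"
      by (simp add: inner[OF S])
    also have "\<dots> = (\<integral>\<^sup>+\<omega>. \<integral>\<^sup>+z. ennreal (G (z - R \<omega>)) * indicator S z \<partial>lborel \<partial>M)"
    proof -
      have "(\<lambda>w. \<integral>\<^sup>+z. ennreal (G (z - w)) * indicator S z \<partial>lborel) \<in> borel_measurable (borel \<Otimes>\<^sub>M borel)"
        unfolding lborel_prod[symmetric] minus_prod_def by measurable
      then show ?thesis
        by (intro nn_integral_distr) simp_all
    qed
    also have "\<dots> = (\<integral>\<^sup>+z. \<integral>\<^sup>+\<omega>. ennreal (G (z - R \<omega>)) * indicator S z \<partial>M \<partial>lborel)"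
    proof (rule PL.Fubini'[symmetric])
      show "case_prod (\<lambda>\<omega> z. ennreal (G (z - R \<omega>)) * indicator S z) \<in> borel_measurable (M \<Otimes>\<^sub>M lborel)"
        unfolding lborel_prod[symmetric] minus_prod_def split_beta by measurable
    qed
    also have "\<dots> = (\<integral>\<^sup>+z. ennreal (D z) * indicator S z \<partial>lborel)"
    proof (rule nn_integral_cong)
      fix z
      have "(\<integral>\<^sup>+\<omega>. ennreal (G (z - R \<omega>)) * indicator S z \<partial>M) = (\<integral>\<^sup>+\<omega>. ennreal (G (z - R \<omega>)) \<partial>M) * indicator S z"
        using G_int by (intro nn_integral_multc) auto
      also have "(\<integral>\<^sup>+\<omega>. ennreal (G (z - R \<omega>)) \<partial>M) = ennreal (D z)"
        unfolding D_def using G_int G_nonneg by (intro nn_integral_eq_integral) auto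
      finally show "(\<integral>\<^sup>+\<omega>. ennreal (G (z - R \<omega>)) * indicator S z \<partial>M) = ennreal (D z) * indicator S z" .
    qed
    also have "\<dots> = emeasure (density lborel (\<lambda>z. ennreal (D z))) S"
      using D_meas S by (subst emeasure_density) auto
    finally show "emeasure (distr M lborel (\<lambda>\<omega>. (lincomb \<alpha> I \<omega>, lincomb \<beta> I \<omega>))) S =
      emeasure (density lborel (\<lambda>z. ennreal (D z))) S" .
  qed simp
  moreover have "(\<lambda>\<omega>. (lincomb \<alpha> I \<omega>, lincomb \<beta> I \<omega>)) \<in> M \<rightarrow>\<^sub>M lborel"
    using lincomb_measurable[of I] by (simp add: borel_prod[symmetric])
  ultimately have "distributed M lborel (\<lambda>\<omega>. (lincomb \<alpha> I \<omega>, lincomb \<beta> I \<omega>)) (\<lambda>z. ennreal (D z))"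
    using D_meas by (simp add: distributed_def)
  then show ?thesis
    using D_cont D_nonneg by blast
qed

text \<open>If \<open>\<alpha> i = 0\<close>, the nonzero determinant gives
  \<open>\<alpha> j \<noteq> 0\<close>, and exchanging \<open>i\<close> and \<open>j\<close> only
  changes its sign.\<close>

lemma exists_continuous_joint_density:
  assumes ij: "i \<in> I" "j \<in> I" and det: "\<alpha> i * \<beta> j - \<beta> i * \<alpha> j \<noteq> 0"
  shows "\<exists>D. continuous_on UNIV D \<and> (\<forall>z. 0 \<le> D z) \<and>
    distributed M lborel (\<lambda>\<omega>. (lincomb \<alpha> I \<omega>, lincomb \<beta> I \<omega>)) (\<lambda>z. ennreal (D z))"
proof (cases "\<alpha> i = 0")
  case True
  with det have "\<alpha> j \<noteq> 0" "\<alpha> j * \<beta> i - \<beta> j * \<alpha> i \<noteq> 0"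
    by auto
  then show ?thesis
    using ij by (intro exists_continuous_joint_density_aux[of j i]) auto
qed (use ij det in \<open>intro exists_continuous_joint_density_aux[of i j]; auto\<close>)

end

text \<open>A continuous density at the line \<open>s = 0\<close> is controlled by averages over thin strips around
  that line (Fatou). The shear \<open>t - \<kappa> * s\<close> is harmless, since it vanishes in the limit.\<close>

lemma (in prob_space) kac_rice_integral_le_strip:
  fixes X Y :: "'a \<Rightarrow> real" and D :: "real \<times> real \<Rightarrow> real"
  assumes dens: "distributed M lborel (\<lambda>\<omega>. (X \<omega>, Y \<omega>)) (\<lambda>z. ennreal (D z))"
    and cont: "continuous_on UNIV D" and nonneg: "\<And>z. 0 \<le> D z" and L: "0 \<le> L"
    and strip: "\<And>e. e > 0 \<Longrightarrow>
      (\<integral>\<^sup>+\<omega>. ennreal \<bar>Y \<omega> - \<kappa> * X \<omega>\<bar> * indicator {-e<..<e} (X \<omega>) \<partial>M) \<le> ennreal (2 * e * L)"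
  shows "(\<integral>\<^sup>+t. ennreal (\<bar>t\<bar> * D (0, t)) \<partial>lborel) \<le> ennreal L"
proof -
  have [measurable]: "D \<in> borel_measurable (borel \<Otimes>\<^sub>M borel)"
    using borel_measurable_continuous_onI[OF cont] by (simp add: borel_prod)
  \<comment> \<open>Rescaling the strip by \<open>s = e * r\<close> fixes the domain to
    \<open>]-1, 1[\<close>, so that the integrands converge pointwise as \<open>e\<close> tends to
    0.\<close>
  define g where "g = (\<lambda>e (r, t). ennreal (\<bar>t - \<kappa> * (e * r)\<bar> * D (e * r, t)) * indicator {-1<..<1::real} r)"
  have [measurable]: "g e \<in> borel_measurable (borel \<Otimes>\<^sub>M borel)" for e
    unfolding g_def by measurable
  have g_le: "(\<integral>\<^sup>+z. g e z \<partial>(lborel \<Otimes>\<^sub>M lborel)) \<le> ennreal (2 * L)" if e: "e > 0" for e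
  proof -
    let ?h = "\<lambda>(s, t). ennreal \<bar>t - \<kappa> * s\<bar> * indicator {-e<..<e} s :: ennreal"
    have [measurable]: "?h \<in> borel_measurable (borel \<Otimes>\<^sub>M borel)"
      by measurable
    \<comment> \<open>The substitution produces a factor \<open>e\<close> on the left, which cancels
      the \<open>e\<close> in the strip bound.\<close>
    have "ennreal e * (\<integral>\<^sup>+z. g e z \<partial>(lborel \<Otimes>\<^sub>M lborel)) = ennreal e * (\<integral>\<^sup>+r. \<integral>\<^sup>+t. g e (r, t) \<partial>lborel \<partial>lborel)"
      by (subst lborel.nn_integral_fst[symmetric]) auto
    also have "\<dots> = ennreal \<bar>e\<bar> * (\<integral>\<^sup>+r. (\<lambda>s. \<integral>\<^sup>+t. ennreal (D (s, t)) * ?h (s, t) \<partial>lborel) (0 + e * r) \<partial>lborel)"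
    proof -
      have "g e (r, t) = ennreal (D (e * r, t)) * ?h (e * r, t)" for r t
        using e nonneg
        by (auto simp: g_def ennreal_mult mult.commute mult_less_cancel_left_pos[of e r 1, simplified]
            mult_less_cancel_left_pos[of e "-1" r, simplified] split: split_indicator)
      then show ?thesis
        using e by simp
    qed
    also have "\<dots> = (\<integral>\<^sup>+s. \<integral>\<^sup>+t. ennreal (D (s, t)) * ?h (s, t) \<partial>lborel \<partial>lborel)"
      using e by (intro nn_integral_real_affine[symmetric]) auto
    also have "\<dots> = (\<integral>\<^sup>+z. ennreal (D z) * ?h z \<partial>lborel)"
      unfolding lborel_prod[symmetric] by (rule lborel.nn_integral_fst) measurable
    also have "\<dots> = (\<integral>\<^sup>+\<omega>. ?h (X \<omega>, Y \<omega>) \<partial>M)"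
      by (rule distributed_nn_integral[OF dens]) (simp add: lborel_prod[symmetric])
    also have "\<dots> \<le> ennreal e * ennreal (2 * L)"
      using strip[OF e] e L by (simp add: mult_ac flip: ennreal_mult)
    finally show ?thesis
      using e by (subst (asm) ennreal_mult_le_mult_iff) auto
  qed
  have lim: "(\<lambda>m. g (1 / Suc m) z) \<longlonglongrightarrow> g 0 z" for z
  proof -
    obtain r t where z: "z = (r, t)" by (cases z)
    have e0: "(\<lambda>m. 1 / real (Suc m) * r) \<longlonglongrightarrow> 0 * r"
      by (intro tendsto_mult tendsto_const LIMSEQ_Suc[OF lim_1_over_n])
    have "(\<lambda>m. D (1 / real (Suc m) * r, t)) \<longlonglongrightarrow> D (0 * r, t)"
      by (intro continuous_on_tendsto_compose[OF cont] tendsto_Pair e0 tendsto_const) auto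
    then have "(\<lambda>m. ennreal (\<bar>t - \<kappa> * (1 / real (Suc m) * r)\<bar> * D (1 / real (Suc m) * r, t)))
        \<longlonglongrightarrow> ennreal (\<bar>t - \<kappa> * (0 * r)\<bar> * D (0 * r, t))"
      by (intro tendsto_ennrealI tendsto_mult tendsto_rabs tendsto_diff tendsto_const e0)
    then show ?thesis
      unfolding z g_def prod.case by (auto split: split_indicator)
  qed
  \<comment> \<open>The factor 2 is the length of \<open>]-1, 1[\<close>; at \<open>e = 0\<close>
    the integrand depends on \<open>r\<close> only through the indicator.\<close>
  have "2 * (\<integral>\<^sup>+t. ennreal (\<bar>t\<bar> * D (0, t)) \<partial>lborel)
      = (\<integral>\<^sup>+r. (\<integral>\<^sup>+t. ennreal (\<bar>t\<bar> * D (0, t)) \<partial>lborel) * indicator {-1<..<1::real} r \<partial>lborel)"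
    by (subst nn_integral_cmult_indicator) (auto simp: mult.commute)
  also have "\<dots> = (\<integral>\<^sup>+r. \<integral>\<^sup>+t. g 0 (r, t) \<partial>lborel \<partial>lborel)"
    by (intro nn_integral_cong) (simp add: g_def nn_integral_multc)
  also have "\<dots> = (\<integral>\<^sup>+z. g 0 z \<partial>(lborel \<Otimes>\<^sub>M lborel))"
    by (rule lborel.nn_integral_fst) measurable
  also have "\<dots> = (\<integral>\<^sup>+z. liminf (\<lambda>m. g (1 / Suc m) z) \<partial>(lborel \<Otimes>\<^sub>M lborel))"
    using lim_imp_Liminf[OF _ lim] by simp
  also have "\<dots> \<le> liminf (\<lambda>m. \<integral>\<^sup>+z. g (1 / Suc m) z \<partial>(lborel \<Otimes>\<^sub>M lborel))"
    by (rule nn_integral_liminf) measurable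
  also have "\<dots> \<le> ennreal (2 * L)"
    using g_le by (intro Liminf_le) auto
  also have "\<dots> = 2 * ennreal L"
    using L by (simp add: ennreal_mult)
  finally show ?thesis
    by (subst (asm) ennreal_mult_le_mult_iff) auto
qed

text \<open>This is contained in Lagrange's identity: if all minors vanish, the double sums for the
  product of the squared norms and for the squared inner product agree term by term.\<close>

lemma exists_nonzero_minor:
  fixes \<alpha> \<beta> :: "'i \<Rightarrow> real"
  assumes "(\<Sum>i\<in>I. (\<beta> i)\<^sup>2) * (\<Sum>i\<in>I. (\<alpha> i)\<^sup>2) - (\<Sum>i\<in>I. \<alpha> i * \<beta> i)\<^sup>2 > 0"
  shows "\<exists>i\<in>I. \<exists>j\<in>I. \<alpha> i * \<beta> j - \<beta> i * \<alpha> j \<noteq> 0"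
proof (rule ccontr)
  assume "\<not> (\<exists>i\<in>I. \<exists>j\<in>I. \<alpha> i * \<beta> j - \<beta> i * \<alpha> j \<noteq> 0)"
  then have eq: "\<beta> i * \<alpha> j = \<alpha> i * \<beta> j" if "i \<in> I" "j \<in> I" for i j
    using that by fastforce
  have "(\<Sum>i\<in>I. (\<beta> i)\<^sup>2) * (\<Sum>j\<in>I. (\<alpha> j)\<^sup>2) = (\<Sum>i\<in>I. \<Sum>j\<in>I. (\<alpha> i * \<beta> i) * (\<alpha> j * \<beta> j))"
    unfolding sum_product
  proof (intro sum.cong refl)
    fix i j assume "i \<in> I" "j \<in> I"
    then show "(\<beta> i)\<^sup>2 * (\<alpha> j)\<^sup>2 = (\<alpha> i * \<beta> i) * (\<alpha> j * \<beta> j)"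
      using eq[of i j] by (metis (no_types) mult.assoc mult.left_commute power2_eq_square)
  qed
  also have "\<dots> = (\<Sum>i\<in>I. \<alpha> i * \<beta> i)\<^sup>2"
    by (simp add: power2_eq_square sum_product)
  finally show False
    using assms by simp
qed

section \<open>Assembly of the density bound\<close>

theorem theorem2:
  fixes M :: "'a measure" and \<eta> :: "nat \<Rightarrow> 'a \<Rightarrow> real"
    and f :: "nat \<Rightarrow> complex \<Rightarrow> complex" and n :: nat
    and a q C2 C3 x :: real
    and \<phi>1 \<phi>2 \<phi>3 :: "real \<Rightarrow> complex"
  assumes "prob_space M"
    and "n \<ge> 1"
    and entire: "\<And>k. k \<le> n \<Longrightarrow> f k holomorphic_on UNIV"
    and real_on_real: "\<And>k t. k \<le> n \<Longrightarrow> f k (complex_of_real t) \<in> \<real>"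
    and rv: "\<And>k. k \<le> n \<Longrightarrow> \<eta> k \<in> borel_measurable M"
    and indep: "prob_space.indep_vars M (\<lambda>_. borel) \<eta> {0..n}"
    and ident: "\<And>k. k \<le> n \<Longrightarrow> distr M borel (\<eta> k) = distr M borel (\<eta> 0)"
    and mean: "\<And>k. k \<le> n \<Longrightarrow> integrable M (\<eta> k) \<and> (\<integral>\<omega>. \<eta> k \<omega> \<partial>M) = 0"
    and var: "\<And>k. k \<le> n \<Longrightarrow> integrable M (\<lambda>\<omega>. (\<eta> k \<omega>)^2) \<and> (\<integral>\<omega>. (\<eta> k \<omega>)^2 \<partial>M) = 1"
    and "a > 0" and "q \<ge> 1"
    and decay: "\<And>s. norm (char (distr M borel (\<eta> 0)) s) \<le> 1 / (1 + a * s^2) powr q"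
    and d1: "\<And>s. ((\<lambda>t. char (distr M borel (\<eta> 0)) t) has_vector_derivative \<phi>1 s) (at s)"
    and d2: "\<And>s. (\<phi>1 has_vector_derivative \<phi>2 s) (at s)"
    and d3: "\<And>s. (\<phi>2 has_vector_derivative \<phi>3 s) (at s)"
    and "C2 > 0" and "C3 > 0"
    and bd2: "\<And>s. norm (\<phi>2 s) \<le> C2"
    and bd3: "\<And>s. norm (\<phi>3 s) \<le> C3"
    and Kpos: "Kn f n x > 0"
    and Dpos: "Kn11 f n x * Kn f n x - (Kn01 f n x)^2 > 0"
  shows "kac_rice_density M \<eta> f n x \<le>
    ennreal (calK f n x * (1 / (a * q)) *
      (k1 + C3 * k2 + (1 / sqrt (a * q)) * C2 * (k3 + C2 * k4)))"
proof -
  interpret normalized_indep_family M \<eta> "{0..n}" a q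
  proof (rule normalized_indep_family.intro[OF \<open>prob_space M\<close>], unfold_locales)
    show "cmod (char (distr M borel (\<eta> k)) s) \<le> 1 / (1 + a * s\<^sup>2) powr q" if "k \<in> {0..n}" for k s
      using decay[of s] ident[of k] that by simp
  qed (use indep mean var \<open>a > 0\<close> \<open>q \<ge> 1\<close> in auto)
  define \<alpha> where "\<alpha> = (\<lambda>k. rfun (f k) x)"
  define \<gamma> where "\<gamma> = (\<lambda>k. rderiv (f k) x)"
  \<comment> \<open>The Gram-Schmidt coefficient, which makes \<beta> orthogonal to
    \<alpha>.\<close>
  define \<kappa> where "\<kappa> = Kn01 f n x / Kn f n x"
  define \<beta> where "\<beta> = (\<lambda>k. \<gamma> k - \<kappa> * \<alpha> k)"
  have K: "Kn f n x = (\<Sum>k\<in>{0..n}. (\<alpha> k)\<^sup>2)" "Kn01 f n x = (\<Sum>k\<in>{0..n}. \<alpha> k * \<gamma> k)"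
    "Kn11 f n x = (\<Sum>k\<in>{0..n}. (\<gamma> k)\<^sup>2)"
    by (simp_all add: Kn_def Kn01_def Kn11_def \<alpha>_def \<gamma>_def)
  have P: "Pn \<eta> f n x = lincomb \<alpha> {0..n}" "Pn' \<eta> f n x = lincomb \<gamma> {0..n}"
    by (simp_all add: Pn_def Pn'_def fun_eq_iff \<alpha>_def \<gamma>_def mult.commute)
  have orth: "(\<Sum>k\<in>{0..n}. \<alpha> k * \<beta> k) = 0"
  proof -
    have "(\<Sum>k\<in>{0..n}. \<alpha> k * \<beta> k) = Kn01 f n x - \<kappa> * Kn f n x"
      unfolding K by (simp add: \<beta>_def sum_subtractf sum_distrib_left algebra_simps power2_eq_square)
    then show ?thesis
      using Kpos by (simp add: \<kappa>_def)
  qed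
  \<comment> \<open>The squared distance of \<gamma> from the line spanned by \<alpha> is the Gram
    determinant over the squared norm of \<alpha>.\<close>
  have \<beta>_sq: "(\<Sum>k\<in>{0..n}. (\<beta> k)\<^sup>2) = (Kn11 f n x * Kn f n x - (Kn01 f n x)\<^sup>2) / Kn f n x"
  proof -
    have "(\<Sum>k\<in>{0..n}. (\<beta> k)\<^sup>2) = Kn11 f n x - 2 * \<kappa> * Kn01 f n x + \<kappa>\<^sup>2 * Kn f n x"
      unfolding K by (simp add: \<beta>_def sum_subtractf sum.distrib sum_distrib_left algebra_simps power2_eq_square)
    then show ?thesis
      using Kpos by (simp add: \<kappa>_def field_simps power2_eq_square)
  qed
  have calK: "calK f n x = sqrt (\<Sum>k\<in>{0..n}. (\<beta> k)\<^sup>2) / sqrt (\<Sum>k\<in>{0..n}. (\<alpha> k)\<^sup>2)"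
    unfolding \<beta>_sq K(1)[symmetric] calK_def using Kpos
    by (simp add: real_sqrt_divide flip: real_sqrt_mult)
  define L where "L = sqrt 2 / sqrt (a * q) * calK f n x"
  have calK_nonneg: "calK f n x \<ge> 0"
    using Dpos Kpos by (simp add: calK_def)
  have aq: "a * q > 0"
    using \<open>a > 0\<close> \<open>q \<ge> 1\<close> by simp
  have L_nonneg: "L \<ge> 0"
    using calK_nonneg aq by (simp add: L_def)
  have "\<exists>i\<in>{0..n}. \<exists>j\<in>{0..n}. \<alpha> i * \<gamma> j - \<gamma> i * \<alpha> j \<noteq> 0"
    using Dpos unfolding K by (rule exists_nonzero_minor)
  then have "\<exists>D. continuous_on UNIV D \<and> (\<forall>z. 0 \<le> D z) \<and>
      distributed M lborel (\<lambda>\<omega>. (Pn \<eta> f n x \<omega>, Pn' \<eta> f n x \<omega>)) (\<lambda>z. ennreal (D z))"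
    unfolding P using exists_continuous_joint_density by blast
  from someI_ex[OF this] have D: "continuous_on UNIV (joint_density M \<eta> f n x)"
    "\<And>z. 0 \<le> joint_density M \<eta> f n x z"
    "distributed M lborel (\<lambda>\<omega>. (Pn \<eta> f n x \<omega>, Pn' \<eta> f n x \<omega>)) (\<lambda>z. ennreal (joint_density M \<eta> f n x z))"
    unfolding joint_density_def by blast+
  \<comment> \<open>The shear by \<kappa> turns the coefficients \<gamma> of the derivative into
    \<beta>, to which the small-ball estimate applies.\<close>
  have strip: "(\<integral>\<^sup>+\<omega>. ennreal \<bar>Pn' \<eta> f n x \<omega> - \<kappa> * Pn \<eta> f n x \<omega>\<bar> * indicator {-e<..<e} (Pn \<eta> f n x \<omega>) \<partial>M)
      \<le> ennreal (2 * e * L)" if "e > 0" for e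
  proof -
    have "Pn' \<eta> f n x \<omega> - \<kappa> * Pn \<eta> f n x \<omega> = lincomb \<beta> {0..n} \<omega>" for \<omega>
      unfolding P by (simp add: \<beta>_def sum_subtractf sum_distrib_left algebra_simps)
    then show ?thesis
      using small_ball_le[OF that _ orth] Kpos by (simp add: P K(1) L_def calK)
  qed
  have "kac_rice_density M \<eta> f n x \<le> ennreal L"
    unfolding kac_rice_density_def
    by (rule kac_rice_integral_le_strip[OF D(3,1,2) L_nonneg strip])
  also have "\<dots> \<le> ennreal (calK f n x * (1 / (a * q)) *
      (k1 + C3 * k2 + (1 / sqrt (a * q)) * C2 * (k3 + C2 * k4)))"
  proof (rule ennreal_leI)
    interpret R: real_distribution "distr M borel (\<eta> 0)"
      using rv by (intro real_distribution_distr) simp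
    let ?\<phi> = "char (distr M borel (\<eta> 0))"
    \<comment> \<open>The curvature lemma is applied to the real part of the characteristic
      function: its value at 0 is 1, the modulus bound controls it, and its second derivative is at
      least \<open>- C2\<close>.\<close>
    have "C2 \<ge> 2 * (a * q)"
    proof (rule curvature_ge_if_quadratic_decay[OF aq \<open>C2 > 0\<close>])
      show "Re (?\<phi> 0) = 1"
        by (simp add: R.char_zero)
      show "Re (?\<phi> s) \<le> 1 / (1 + a * q * s\<^sup>2)" for s
        using char_lincomb_decay[of "{0}" "\<lambda>_. 1" s] complex_Re_le_cmod[of "?\<phi> s"] by simp
      show "((\<lambda>s. Re (?\<phi> s)) has_real_derivative Re (\<phi>1 s)) (at s)" for s
        using d1[of s] by (simp add: has_vector_derivative_complex_iff)
      show "((\<lambda>s. Re (\<phi>1 s)) has_real_derivative Re (\<phi>2 s)) (at s)" for s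
        using d2[of s] by (simp add: has_vector_derivative_complex_iff)
      show "- C2 \<le> Re (\<phi>2 s)" for s
        using bd2[of s] abs_Re_le_cmod[of "\<phi>2 s"] by linarith
    qed
    from density_bound_le_k_bound[OF aq this, of C3] \<open>C3 > 0\<close>
    have "calK f n x * (sqrt 2 / sqrt (a * q)) \<le> calK f n x *
        (1 / (a * q) * (k1 + C3 * k2 + 1 / sqrt (a * q) * C2 * (k3 + C2 * k4)))"
      using calK_nonneg by (intro mult_left_mono) auto
    then show "L \<le> calK f n x * (1 / (a * q)) *
        (k1 + C3 * k2 + (1 / sqrt (a * q)) * C2 * (k3 + C2 * k4))"
      by (simp add: L_def mult_ac)
  qed
  finally show ?thesis .
qed

end
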